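(* Let $n\ge2$, $\gamma>1$, $L>0$ and $\phi=\frac{2}{1+\gamma}$. There is a sufficiently small constant $K_0=K_0(n,\gamma,L)>0$ such that the following holds for every $0<K\le K_0$. Let $\Gamma=\{x_n=g(x')\}$ with $\|g\|_{C^{0,1}(B_{20}')}\le L$ and $$-\frac1K+\sqrt{\frac1{K^2}-|x'|^2}\le g(x')\le\frac1K-\sqrt{\frac1{K^2}-|x'|^2}\qquad\text{in }B_{20}'.$$ Suppose that $u$ is a solution of $-\Delta u=u^{-\gamma}$ in $\mathcal{GC}_{20}(0)$ and that $u$ vanishes on $\Gamma$. Denote $\lambda=u(\vec e_n)$. Then $\lambda\gtrsim1$, and for $t\in[0,1]$ $$u(t\vec e_n)\sim\begin{cases}t^{\phi},&\text{if }t\le\lambda^{\frac{1+\gamma}{1-\gamma}},\\ \lambda t,&\text{if }t\ge\lambda^{\frac{1+\gamma}{1-\gamma}}.\end{cases}$$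
   Context: Points of $\mathbb{R}^n$ are written $x=(x',x_n)$; $B_r'$ is the ball of radius $r$ centered at $0$ in $\mathbb{R}^{n-1}$; $\vec e_n$ is the $n$-th unit vector. The grounded cylinder at the origin (note $g(0)=0$) is $$\mathcal{GC}_r(0)=\{y=(y',y_n):|y'|\le r,\ 0\le y_n-g(y')\le r\}.$$ A solution is positive in $\{y_n>g(y')\}$, satisfies the equation classically in the interior of the cylinder, and is continuous up to $\Gamma$, where it equals $0$. $q_1\lesssim q_2$ means $q_1\le Cq_2$ for a constant $C>0$ depending only on $(n,\gamma,L,K)$ (in particular independent of $u$, $\lambda$, $t$); $q_1\gtrsim q_2$ means $q_2\lesssim q_1$; $q_1\sim q_2$ means both. *)

theory Defs
  imports "HOL-Analysis.Analysis"
begin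

text \<open>
  A point \<open>x = (x', x\<^sub>n)\<close> of \<open>n\<close>-space is an element of \<open>(real ^ 'm) \<times> real\<close>, so that
  \<open>n = CARD('m) + 1\<close> ranges over all integers \<open>n \<ge> 2\<close>. The norm of the product type is the
  Euclidean norm.
\<close>

definition e_n :: "(real ^ 'm) \<times> real" where
  "e_n = (0, 1)"

definition grounded_cylinder :: "(real ^ 'm \<Rightarrow> real) \<Rightarrow> real \<Rightarrow> ((real ^ 'm) \<times> real) set" where
  "grounded_cylinder g r =
     {y. norm (fst y) \<le> r \<and> 0 \<le> snd y - g (fst y) \<and> snd y - g (fst y) \<le> r}"

definition graph_over :: "(real ^ 'm) set \<Rightarrow> (real ^ 'm \<Rightarrow> real) \<Rightarrow> ((real ^ 'm) \<times> real) set" where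
  "graph_over S g = {x. fst x \<in> S \<and> snd x = g (fst x)}"

text \<open>The \<open>C\<^sup>0\<^sup>,\<^sup>1\<close> norm takes values in \<^typ>\<open>ennreal\<close>, so it is infinite when a supremum is.\<close>

definition C01_norm :: "'a::metric_space set \<Rightarrow> ('a \<Rightarrow> real) \<Rightarrow> ennreal" where
  "C01_norm S g =
     (SUP x\<in>S. ennreal \<bar>g x\<bar>) +
     (SUP (x, y)\<in>{(x, y). x \<in> S \<and> y \<in> S \<and> x \<noteq> y}. ennreal (\<bar>g x - g y\<bar> / dist x y))"

definition partial_deriv :: "'a::real_normed_vector \<Rightarrow> ('a \<Rightarrow> real) \<Rightarrow> 'a \<Rightarrow> real" where
  "partial_deriv b u x = deriv (\<lambda>s. u (x + s *\<^sub>R b)) 0"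

definition C1_on :: "'a::euclidean_space set \<Rightarrow> ('a \<Rightarrow> real) \<Rightarrow> bool" where
  "C1_on S u \<longleftrightarrow> continuous_on S u \<and>
     (\<forall>b\<in>Basis. (\<forall>x\<in>S. (\<lambda>s. u (x + s *\<^sub>R b)) differentiable (at 0)) \<and>
        continuous_on S (partial_deriv b u))"

definition C2_on :: "'a::euclidean_space set \<Rightarrow> ('a \<Rightarrow> real) \<Rightarrow> bool" where
  "C2_on S u \<longleftrightarrow> C1_on S u \<and> (\<forall>b\<in>Basis. C1_on S (partial_deriv b u))"

definition laplacian :: "('a::euclidean_space \<Rightarrow> real) \<Rightarrow> 'a \<Rightarrow> real" where
  "laplacian u x = (\<Sum>b\<in>Basis. partial_deriv b (partial_deriv b u) x)"

text \<open>
  Solutions of \<open>- \<Delta> u = u\<^bsup>-\<gamma>\<^esup>\<close> in the grounded cylinder of radius \<open>r\<close> that vanish on the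
  graph of \<open>g\<close>. No regularity is imposed at the lateral and top parts of the boundary.
\<close>

definition is_solution ::
    "real \<Rightarrow> (real ^ 'm \<Rightarrow> real) \<Rightarrow> real \<Rightarrow> ((real ^ 'm) \<times> real \<Rightarrow> real) \<Rightarrow> bool" where
  "is_solution \<gamma> g r u \<longleftrightarrow>
     (\<forall>y\<in>grounded_cylinder g r. g (fst y) < snd y \<longrightarrow> 0 < u y) \<and>
     C2_on (interior (grounded_cylinder g r)) u \<and>
     (\<forall>y\<in>interior (grounded_cylinder g r). - laplacian u y = u y powr (- \<gamma>)) \<and>
     continuous_on (interior (grounded_cylinder g r) \<union> graph_over (ball 0 r) g) u \<and>
     (\<forall>y\<in>graph_over (ball 0 r) g. u y = 0)"

end

theory Submission
  imports Defs
begin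

text \<open>
  Everything rests on the pointwise maximum principle. On a ball of radius \<open>r\<close> inside the domain,
  comparison with a paraboloid gives \<open>u \<gtrsim> r\<^bsup>\<phi>\<^esup>\<close> at the centre, hence \<open>\<lambda> \<gtrsim> 1\<close> and
  \<open>u(t e\<^sub>n) \<gtrsim> t\<^bsup>\<phi>\<^esup>\<close>; at scale \<open>r\<close> the right-hand side is then at most of order \<open>r\<^bsup>\<phi> - 2\<^esup>\<close>.

  The core is the Carleson estimate \<open>u \<lesssim> \<lambda>\<close> near the origin. Maximise \<open>u(x) (2 - |x|)\<^bsup>N\<^esup>\<close>, so that
  around the maximum point \<open>x\<close>, at scale \<open>h = 2 - |x|\<close>, one has \<open>u \<le> 2\<^bsup>N\<^esup> u(x)\<close>. If \<open>x\<close> is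
  close to the graph relative to \<open>h\<close>, decay at the boundary (barriers from exterior balls, which the
  Lipschitz condition provides at every scale) gives \<open>u(x) \<lesssim> 1 \<lesssim> \<lambda>\<close>. Otherwise reflection in
  coordinate hyperplanes gives an interior Lipschitz estimate, so \<open>u \<ge> u(x)/2\<close> on a ball of radius
  comparable to \<open>h\<close>, and superharmonicity carries this bound upwards and to \<open>e\<^sub>n\<close>, losing at most a
  factor \<open>h\<^bsup>N\<^esup>\<close>, where \<open>N\<close> depends only on \<open>n\<close> and \<open>L\<close>.

  With \<open>u \<lesssim> \<lambda>\<close> at hand, a Hopf barrier in the interior tangent ball gives \<open>u(t e\<^sub>n) \<gtrsim> \<lambda> t\<close>, and the
  barrier \<open>A (\<rho>\<^bsup>\<phi>\<^esup> + \<lambda> \<rho>)\<close>, with \<open>\<rho> = 1 - |x + e\<^sub>n|\<^bsup>-2n\<^esup>\<close> vanishing on an exterior tangent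
  ball, gives \<open>u(t e\<^sub>n) \<lesssim> t\<^bsup>\<phi>\<^esup> + \<lambda> t\<close>.
\<close>

section \<open>Maximum principle\<close>

text \<open>A relation rather than an iterated \<open>deriv\<close>, which has a value even where no
  derivative exists. Differentiability in a whole neighbourhood of 0 is built in, as the second
  derivative test requires.\<close>

definition second_deriv0 :: "(real \<Rightarrow> real) \<Rightarrow> real \<Rightarrow> bool" where
  "second_deriv0 f D \<longleftrightarrow> (\<exists>f'. (\<forall>\<^sub>F s in nhds 0. (f has_real_derivative f' s) (at s)) \<and>
     (f' has_real_derivative D) (at 0))"

section \<open>Calculus of second derivatives along a line\<close>

lemma second_deriv0_add:
  assumes "second_deriv0 f D" "second_deriv0 g E"
  shows "second_deriv0 (\<lambda>s. f s + g s) (D + E)"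
proof -
  from assms obtain f' g' where
    1: "\<forall>\<^sub>F s in nhds 0. (f has_real_derivative f' s) (at s)" "(f' has_real_derivative D) (at 0)" and
    2: "\<forall>\<^sub>F s in nhds 0. (g has_real_derivative g' s) (at s)" "(g' has_real_derivative E) (at 0)"
    unfolding second_deriv0_def by blast
  show ?thesis unfolding second_deriv0_def
  proof (intro exI[of _ "\<lambda>s. f' s + g' s"] conjI)
    show "\<forall>\<^sub>F s in nhds 0. ((\<lambda>s. f s + g s) has_real_derivative f' s + g' s) (at s)"
      using 1(1) 2(1) by eventually_elim (auto intro!: derivative_intros)
  qed (auto intro!: derivative_intros 1 2)
qed

lemma second_deriv0_cmult:
  assumes "second_deriv0 f D"
  shows "second_deriv0 (\<lambda>s. c * f s) (c * D)"
proof -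
  from assms obtain f' where
    1: "\<forall>\<^sub>F s in nhds 0. (f has_real_derivative f' s) (at s)" "(f' has_real_derivative D) (at 0)"
    unfolding second_deriv0_def by blast
  show ?thesis unfolding second_deriv0_def
  proof (intro exI[of _ "\<lambda>s. c * f' s"] conjI)
    show "\<forall>\<^sub>F s in nhds 0. ((\<lambda>s. c * f s) has_real_derivative c * f' s) (at s)"
      using 1(1) by eventually_elim (auto intro!: derivative_eq_intros)
  qed (auto intro!: derivative_eq_intros 1)
qed

lemma second_deriv0_diff:
  assumes "second_deriv0 f D" "second_deriv0 g E"
  shows "second_deriv0 (\<lambda>s. f s - g s) (D - E)"
  using second_deriv0_add[OF assms(1) second_deriv0_cmult[OF assms(2), of "-1"]] by simp

lemma second_deriv0_flip:
  assumes "second_deriv0 f D"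
  shows "second_deriv0 (\<lambda>s. f (- s)) D"
proof -
  from assms obtain f' where
    1: "\<forall>\<^sub>F s in nhds 0. (f has_real_derivative f' s) (at s)" and
    2: "(f' has_real_derivative D) (at 0)"
    unfolding second_deriv0_def by blast
  have "filterlim (\<lambda>s::real. - s) (nhds 0) (nhds 0)"
    using tendsto_minus[OF tendsto_ident_at, of "0::real"] by (auto simp: filterlim_def filtermap_nhds_minus)
  then have 1: "\<forall>\<^sub>F s in nhds 0. (f has_real_derivative f' (- s)) (at (- s))"
    using 1 by (auto simp: filterlim_iff)
  show ?thesis unfolding second_deriv0_def
  proof (intro exI[of _ "\<lambda>s. - f' (- s)"] conjI)
    show "\<forall>\<^sub>F s in nhds 0. ((\<lambda>s. f (- s)) has_real_derivative - f' (- s)) (at s)"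
      using 1 by eventually_elim (use DERIV_mirror in blast)
    show "((\<lambda>s. - f' (- s)) has_real_derivative D) (at 0)"
      using DERIV_mirror[of f' D 0] 2 by (auto intro!: derivative_eq_intros simp: DERIV_mirror)
  qed
qed

text \<open>If \<open>D > 0\<close>, then \<open>f'\<close> vanishes at the maximum 0 and is
  positive just to its right, so \<open>f\<close> would increase there.\<close>

lemma second_deriv0_local_max:
  assumes "second_deriv0 f D" "\<forall>\<^sub>F s in nhds 0. f s \<le> f 0"
  shows "D \<le> 0"
proof (rule ccontr)
  assume "\<not> D \<le> 0"
  then have D: "D > 0" by simp
  from assms(1) obtain f' where
    1: "\<forall>\<^sub>F s in nhds 0. (f has_real_derivative f' s) (at s)" and
    2: "(f' has_real_derivative D) (at 0)"
    unfolding second_deriv0_def by blast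
  obtain e where e: "e > 0" "\<And>s. \<bar>s\<bar> < e \<Longrightarrow> (f has_real_derivative f' s) (at s) \<and> f s \<le> f 0"
    using eventually_conj[OF 1 assms(2)] unfolding eventually_nhds_metric by (auto simp: dist_real_def)
  have f0: "f' 0 = 0"
    using DERIV_local_max[of f "f' 0" 0 e] e by auto
  obtain d where d: "d > 0" "\<And>h. 0 < h \<Longrightarrow> h < d \<Longrightarrow> f' 0 < f' (0 + h)"
    using DERIV_pos_inc_right[OF 2 D] by blast
  define r where "r = min d e / 2"
  have r: "0 < r" "r < d" "r < e" using d(1) e(1) by (auto simp: r_def)
  have "f 0 < f r"
  proof (rule DERIV_pos_imp_increasing_open[OF r(1)])
    show "\<exists>y. (f has_real_derivative y) (at x) \<and> y > 0" if "0 < x" "x < r" for x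
      using that e(2)[of x] d(2)[of x] f0 r by (intro exI[of _ "f' x"]) auto
    show "continuous_on {0..r} f"
      by (intro DERIV_atLeastAtMost_imp_continuous_on) (use e(2) r in force)
  qed
  with e(2)[of r] r show False by auto
qed

text \<open>\<open>C2_on\<close> speaks of derivatives at the base point of each line. Sliding the
  base point along the line inside the open set gives differentiability for all parameters near
  0.\<close>

lemma second_deriv0_C2:
  fixes u :: "'a::euclidean_space \<Rightarrow> real"
  assumes "open S" "C2_on S u" "x \<in> S" "b \<in> Basis"
  shows "second_deriv0 (\<lambda>s. u (x + s *\<^sub>R b)) (partial_deriv b (partial_deriv b u) x)"
proof -
  have *: "((\<lambda>s. v (x + s *\<^sub>R b)) has_real_derivative partial_deriv b v (x + s *\<^sub>R b)) (at s)"
    if "C1_on S v" "x + s *\<^sub>R b \<in> S" for v :: "'a \<Rightarrow> real" and s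
  proof -
    have "(\<lambda>h. v (x + s *\<^sub>R b + h *\<^sub>R b)) differentiable (at 0)"
      using that assms(4) unfolding C1_on_def by auto
    then have "((\<lambda>h. v (x + s *\<^sub>R b + h *\<^sub>R b)) has_real_derivative partial_deriv b v (x + s *\<^sub>R b)) (at 0)"
      unfolding partial_deriv_def
      by (metis DERIV_deriv_iff_real_differentiable real_differentiableE real_differentiable_def)
    then have "((\<lambda>h. v (x + (s + h) *\<^sub>R b)) has_real_derivative partial_deriv b v (x + s *\<^sub>R b)) (at 0)"
      by (simp add: algebra_simps)
    then show ?thesis
      using DERIV_shift[of "\<lambda>h. v (x + h *\<^sub>R b)" _ 0 s] by (simp add: add.commute)
  qed
  have "open ((\<lambda>s. x + s *\<^sub>R b) -` S)"
    by (intro open_vimage assms(1)) (auto intro!: continuous_intros)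
  then have ev: "\<forall>\<^sub>F s in nhds 0. x + s *\<^sub>R b \<in> S"
    using assms(3) by (auto simp: eventually_nhds intro!: exI[of _ "(\<lambda>s. x + s *\<^sub>R b) -` S"])
  have c: "C1_on S u" "C1_on S (partial_deriv b u)" using assms by (auto simp: C2_on_def)
  show ?thesis unfolding second_deriv0_def
    using eventually_mono[OF ev *[OF c(1)]] *[OF c(2), of 0] assms(3)
    by (intro exI[of _ "\<lambda>s. partial_deriv b u (x + s *\<^sub>R b)"]) auto
qed

text \<open>Barriers are written as functions \<open>F\<close> of the squared distance to
  \<open>p\<close>, which is a quadratic polynomial along every line. Summed over the n basis
  vectors, the value becomes \<open>2 * n * F' r + 4 * r * F'' r\<close>, the radial Laplacian that
  recurs in all comparisons.\<close>

lemma second_deriv0_radial: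
  fixes x p b :: "'a::euclidean_space"
  assumes b: "b \<in> Basis" and r: "r = (norm (x - p))\<^sup>2"
    and F: "\<forall>\<^sub>F s in nhds r. (F has_real_derivative F' s) (at s)"
    and F': "(F' has_real_derivative F'') (at r)"
  shows "second_deriv0 (\<lambda>s. F ((norm (x + s *\<^sub>R b - p))\<^sup>2))
           (2 * F' r + 4 * ((x - p) \<bullet> b)\<^sup>2 * F'')"
proof -
  define a where "a = (x - p) \<bullet> b"
  define q where "q s = r + 2 * s * a + s\<^sup>2" for s
  have q: "(norm (x + s *\<^sub>R b - p))\<^sup>2 = q s" for s
    using b unfolding q_def a_def r power2_norm_eq_inner
    by (simp add: inner_simps algebra_simps power2_eq_square inner_commute)
  have dq: "(q has_real_derivative 2 * a + 2 * s) (at s)" for s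
    unfolding q_def by (auto intro!: derivative_eq_intros)
  have q0: "q 0 = r" by (simp add: q_def)
  have "isCont q 0" using dq DERIV_isCont by blast
  then have "filterlim q (nhds r) (nhds 0)" by (simp add: isCont_def tendsto_nhds_iff q0 flip: q0)
  then have ev: "\<forall>\<^sub>F s in nhds 0. (F has_real_derivative F' (q s)) (at (q s))"
    using F by (auto simp: filterlim_iff)
  show ?thesis unfolding second_deriv0_def q
  proof (intro exI[of _ "\<lambda>s. F' (q s) * (2 * a + 2 * s)"] conjI)
    show "\<forall>\<^sub>F s in nhds 0. ((\<lambda>s. F (q s)) has_real_derivative F' (q s) * (2 * a + 2 * s)) (at s)"
      using ev by eventually_elim (rule DERIV_chain2[OF _ dq])
    have "((\<lambda>s. F' (q s)) has_real_derivative F'' * (2 * a + 2 * 0)) (at 0)"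
      using F' q0 by (intro DERIV_chain2[OF _ dq]) auto
    then have "((\<lambda>s. F' (q s) * (2 * a + 2 * s)) has_real_derivative
        (F'' * (2 * a + 2 * 0)) * (2 * a + 2 * 0) + 2 * F' (q 0)) (at 0)"
      by (auto intro!: derivative_eq_intros)
    then show "((\<lambda>s. F' (q s) * (2 * a + 2 * s)) has_real_derivative
        2 * F' r + 4 * ((x - p) \<bullet> b)\<^sup>2 * F'') (at 0)"
      by (simp add: q0 a_def power2_eq_square algebra_simps)
  qed
qed

text \<open>At an interior maximum all second derivatives are nonpositive, against their positive
  sum. Since \<open>step\<close> is asked only where \<open>H > 0\<close>, it merges the boundary
  condition with the differential inequality: users must refute \<open>H > 0\<close> at boundary
  points.\<close>

lemma max_principle:
  fixes H :: "'a::euclidean_space \<Rightarrow> real"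
  assumes "compact Q" "continuous_on Q H"
    and step: "\<And>y. y \<in> Q \<Longrightarrow> H y > 0 \<Longrightarrow>
      y \<in> interior Q \<and> (\<exists>D. (\<forall>b\<in>Basis. second_deriv0 (\<lambda>s. H (y + s *\<^sub>R b)) (D b)) \<and> sum D Basis > 0)"
    and "x \<in> Q"
  shows "H x \<le> 0"
proof (rule ccontr)
  assume "\<not> H x \<le> 0"
  obtain y where y: "y \<in> Q" "\<And>z. z \<in> Q \<Longrightarrow> H z \<le> H y"
    using continuous_attains_sup[OF assms(1) _ assms(2)] assms(4) by auto
  have "H y > 0" using y(2)[OF assms(4)] \<open>\<not> H x \<le> 0\<close> by simp
  from step[OF y(1) this] obtain D where int: "y \<in> interior Q" and
    D: "\<And>b. b \<in> Basis \<Longrightarrow> second_deriv0 (\<lambda>s. H (y + s *\<^sub>R b)) (D b)" and pos: "sum D Basis > 0" by auto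
  have "D b \<le> 0" if "b \<in> Basis" for b
  proof (rule second_deriv0_local_max[OF D[OF that]])
    have "open ((\<lambda>s. y + s *\<^sub>R b) -` interior Q)"
      by (intro open_vimage) (auto intro!: continuous_intros)
    then have "\<forall>\<^sub>F s in nhds 0. y + s *\<^sub>R b \<in> interior Q"
      using int by (auto simp: eventually_nhds intro!: exI[of _ "(\<lambda>s. y + s *\<^sub>R b) -` interior Q"])
    then show "\<forall>\<^sub>F s in nhds 0. H (y + s *\<^sub>R b) \<le> H (y + 0 *\<^sub>R b)"
      by eventually_elim (use y(2) interior_subset in fastforce)
  qed
  then have "sum D Basis \<le> 0" by (intro sum_nonpos) auto
  with pos show False by simp
qed

text \<open>The sign \<open>\<sigma>\<close> selects comparison from above (\<open>\<sigma> = 1\<close>) or from below (\<open>\<sigma> = -1\<close>).\<close>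

lemma radial_comparison:
  fixes u :: "'a::euclidean_space \<Rightarrow> real" and F F' F'' :: "real \<Rightarrow> real" and \<sigma> :: real
  assumes "compact Q" "continuous_on Q u" "continuous_on Q (\<lambda>y. F ((norm (y - p))\<^sup>2))"
    and S: "open S" "C2_on S u"
    and step: "\<And>y r. y \<in> Q \<Longrightarrow> r = (norm (y - p))\<^sup>2 \<Longrightarrow> \<sigma> * u y > \<sigma> * F r \<Longrightarrow>
      y \<in> interior Q \<and> y \<in> S \<and>
      (\<forall>\<^sub>F s in nhds r. (F has_real_derivative F' s) (at s)) \<and>
      (F' has_real_derivative F'' r) (at r) \<and>
      \<sigma> * laplacian u y > \<sigma> * (2 * real DIM('a) * F' r + 4 * r * F'' r)"
    and x: "x \<in> Q"
  shows "\<sigma> * u x \<le> \<sigma> * F ((norm (x - p))\<^sup>2)"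
proof -
  define H where "H y = \<sigma> * (u y - F ((norm (y - p))\<^sup>2))" for y
  have "H x \<le> 0"
  proof (rule max_principle[OF assms(1) _ _ x])
    show "continuous_on Q H" unfolding H_def by (intro continuous_intros assms)
    fix y assume y: "y \<in> Q" "H y > 0"
    define r where "r = (norm (y - p))\<^sup>2"
    have gt: "\<sigma> * u y > \<sigma> * F r" using y(2) by (simp add: H_def r_def algebra_simps)
    note st = step[OF y(1) r_def gt]
    define D where "D b = \<sigma> * (partial_deriv b (partial_deriv b u) y -
        (2 * F' r + 4 * ((y - p) \<bullet> b)\<^sup>2 * F'' r))" for b
    have "second_deriv0 (\<lambda>s. H (y + s *\<^sub>R b)) (D b)" if "b \<in> Basis" for b
      unfolding H_def D_def using st that
      by (intro second_deriv0_cmult second_deriv0_diff second_deriv0_C2[OF S] second_deriv0_radial[OF _ r_def]) auto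
    moreover have "sum D Basis = \<sigma> * laplacian u y - \<sigma> * (2 * real DIM('a) * F' r + 4 * r * F'' r)"
    proof -
      have r': "r = (\<Sum>b\<in>Basis. ((y - p) \<bullet> b)\<^sup>2)"
        unfolding r_def by (subst power2_norm_eq_inner, subst euclidean_inner) (simp add: power2_eq_square)
      show ?thesis unfolding D_def laplacian_def
        by (simp add: sum_distrib_left[symmetric] sum_subtractf sum.distrib r' sum_distrib_right[symmetric] algebra_simps)
    qed
    ultimately show "y \<in> interior Q \<and> (\<exists>D. (\<forall>b\<in>Basis. second_deriv0 (\<lambda>s. H (y + s *\<^sub>R b)) (D b)) \<and> sum D Basis > 0)"
      using st by (intro conjI exI[of _ D]) auto
  qed
  then show ?thesis by (simp add: H_def algebra_simps)
qed

section \<open>Interior estimates\<close>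

definition lane_emden_on :: "real \<Rightarrow> 'a::euclidean_space set \<Rightarrow> ('a \<Rightarrow> real) \<Rightarrow> bool" where
  "lane_emden_on \<gamma> S u \<longleftrightarrow> open S \<and> C2_on S u \<and>
     (\<forall>x\<in>S. 0 < u x \<and> - laplacian u x = u x powr (- \<gamma>))"

lemma lane_emden_laplacian_neg:
  assumes "lane_emden_on \<gamma> S u" "y \<in> S"
  shows "laplacian u y < 0"
  using assms unfolding lane_emden_on_def
  by (metis less_numeral_extra(3) neg_0_less_iff_less powr_gt_zero)

lemma lane_emden_continuous:
  assumes "lane_emden_on \<gamma> S u"
  shows "continuous_on S u"
  using assms unfolding lane_emden_on_def C2_on_def C1_on_def by blast

text \<open>\<open>\<phi>\<close> is the scaling exponent of the equation: with size
  \<open>r powr \<phi>\<close> at scale r, both the Laplacian and the right-hand side have size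
  \<open>r powr (\<phi> - 2)\<close>.\<close>

lemma phi_exponents:
  fixes \<gamma> \<phi> :: real
  assumes "\<gamma> > 1" "\<phi> = 2 / (1 + \<gamma>)"
  shows "0 < \<phi>" "\<phi> < 1" "- (\<phi> * \<gamma>) = \<phi> - 2"
proof -
  show "0 < \<phi>" "\<phi> < 1" using assms by simp_all
  show "- (\<phi> * \<gamma>) = \<phi> - 2" using assms by (simp add: field_simps)
qed

lemma powr_phi_neg_gamma:
  fixes \<gamma> \<phi> :: real
  assumes "\<gamma> > 1" "\<phi> = 2 / (1 + \<gamma>)" "c > 0" "r > 0"
  shows "(c * r powr \<phi>) powr (- \<gamma>) = c powr (- \<gamma>) * r powr (\<phi> - 2)"
  using assms phi_exponents(3)[OF assms(1,2)] by (simp add: powr_mult powr_powr)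

text \<open>Where \<open>u\<close> lies below the paraboloid \<open>F\<close>, it is below
  \<open>c * r powr \<phi>\<close>, so \<open>u powr (- \<gamma>)\<close> is large and
  \<open>u\<close> is more strongly superharmonic than \<open>F\<close>. Hence \<open>F - u\<close>
  has no positive maximum.\<close>

lemma interior_lower_bound:
  fixes u :: "'a::euclidean_space \<Rightarrow> real"
  assumes \<gamma>: "\<gamma> > 1" and \<phi>: "\<phi> = 2 / (1 + \<gamma>)" and u: "lane_emden_on \<gamma> S u"
    and sub: "cball x r \<subseteq> S" and r: "r > 0"
  shows "r powr \<phi> / (4 * DIM('a)) \<le> u x"
proof -
  note ph = phi_exponents[OF \<gamma> \<phi>]
  define n where "n = real DIM('a)"
  have n: "n \<ge> 1" by (simp add: n_def Suc_le_eq)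
  \<comment> \<open>The proof needs \<open>2 * n * c \<le> c powr (- \<gamma>)\<close>; as
    \<open>c \<le> 1\<close> and \<open>\<gamma> > 1\<close>, the right side is at least
    \<open>1 / c = 4 * n\<close>. The factor \<open>k\<close> below gives the paraboloid the central
    value \<open>c * r powr \<phi>\<close>.\<close>
  define c where "c = 1 / (4 * n)"
  have c: "0 < c" "c \<le> 1/4" using n by (auto simp: c_def field_simps)
  define k where "k = c * r powr (\<phi> - 2)"
  have k: "k > 0" using c r by (simp add: k_def)
  define F where "F s = k * (r\<^sup>2 - s)" for s
  have kr: "k * r\<^sup>2 = c * r powr \<phi>"
    using r by (simp add: k_def powr_diff powr_numeral)
  have uS: "open S" "C2_on S u" "\<And>y. y \<in> S \<Longrightarrow> 0 < u y" "\<And>y. y \<in> S \<Longrightarrow> - laplacian u y = u y powr (- \<gamma>)"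
    using u by (auto simp: lane_emden_on_def)
  have "-1 * u x \<le> -1 * F ((norm (x - x))\<^sup>2)"
  proof (rule radial_comparison[where Q = "cball x r" and S = S and F' = "\<lambda>_. - k" and F'' = "\<lambda>_. 0"])
    show "continuous_on (cball x r) u"
      using lane_emden_continuous[OF u] sub continuous_on_subset by blast
    show "continuous_on (cball x r) (\<lambda>y. F ((norm (y - x))\<^sup>2))"
      unfolding F_def by (intro continuous_intros)
    fix y s assume y: "y \<in> cball x r" and s: "s = (norm (y - x))\<^sup>2" and lt: "- 1 * F s < - 1 * u y"
    have yS: "y \<in> S" using y sub by auto
    have up: "0 < u y" using uS(3)[OF yS] .
    have "norm (y - x) < r"
    proof (rule ccontr)
      assume "\<not> norm (y - x) < r"
      then have "norm (y - x) = r" using y by (auto simp: dist_norm norm_minus_commute)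
      then show False using lt up by (simp add: F_def s)
    qed
    then have int: "y \<in> interior (cball x r)" by (simp add: dist_norm norm_minus_commute)
    have "u y < k * (r\<^sup>2 - s)" using lt by (simp add: F_def)
    also have "\<dots> \<le> k * r\<^sup>2" using k by (simp add: s)
    finally have "u y < c * r powr \<phi>" using kr by simp
    then have "(c * r powr \<phi>) powr (-\<gamma>) < u y powr (-\<gamma>)"
      using up \<gamma> by (intro powr_less_mono2_neg) auto
    then have A: "c powr (- \<gamma>) * r powr (\<phi> - 2) < u y powr (-\<gamma>)"
      using powr_phi_neg_gamma[OF \<gamma> \<phi> c(1) r] by simp
    have "c powr (-1) \<le> c powr (-\<gamma>)" using c \<gamma> by (intro powr_mono') auto
    then have "4 * n \<le> c powr (-\<gamma>)" using c by (simp add: powr_minus c_def inverse_eq_divide)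
    moreover have "2 * n * c \<le> 4 * n" using c n mult_mono[of "2*n" "4*n" c 1] by auto
    ultimately have "2 * n * c \<le> c powr (-\<gamma>)" by linarith
    then have "2 * n * c * r powr (\<phi> - 2) \<le> c powr (-\<gamma>) * r powr (\<phi> - 2)"
      by (intro mult_right_mono) auto
    then have "2 * n * k < u y powr (-\<gamma>)" using A by (simp add: k_def)
    then have "- 1 * (2 * real DIM('a) * - k + 4 * s * 0) < - 1 * laplacian u y"
      using uS(4)[OF yS] by (simp add: n_def)
    moreover have "\<forall>\<^sub>F s in nhds s. (F has_real_derivative - k) (at s)"
      unfolding F_def by (auto intro!: always_eventually derivative_eq_intros)
    ultimately show "y \<in> interior (cball x r) \<and> y \<in> S \<and> (\<forall>\<^sub>F s in nhds s. (F has_real_derivative - k) (at s)) \<and>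
       ((\<lambda>_. - k) has_real_derivative 0) (at s) \<and>
       - 1 * (2 * real DIM('a) * - k + 4 * s * 0) < - 1 * laplacian u y"
      using int yS by auto
  qed (use r uS in auto)
  then show ?thesis using kr by (simp add: F_def c_def n_def)
qed

text \<open>With s the squared distance in dimension n, this is the function |x|^(-2n), and the
  third identity computes its Laplacian. It is strictly subharmonic away from the centre in every
  dimension, so the plane needs no logarithm.\<close>

lemma inverse_power_radial:
  fixes n s :: real
  assumes "s > 0"
  shows "((\<lambda>s. s powr (- n)) has_real_derivative - n * s powr (- n - 1)) (at s)"
    and "((\<lambda>s. - n * s powr (- n - 1)) has_real_derivative n * (n + 1) * s powr (- n - 2)) (at s)"
    and "2 * n * (- n * s powr (- n - 1)) + 4 * s * (n * (n + 1) * s powr (- n - 2))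
           = n * (2 * n + 4) * s powr (- n - 1)"
proof -
  show "((\<lambda>s. s powr (- n)) has_real_derivative - n * s powr (- n - 1)) (at s)"
    using assms by (auto intro!: derivative_eq_intros)
  show "((\<lambda>s. - n * s powr (- n - 1)) has_real_derivative n * (n + 1) * s powr (- n - 2)) (at s)"
    using assms by (auto intro!: derivative_eq_intros simp: algebra_simps)
  have "s * s powr (- n - 2) = s powr (- n - 1)"
    using assms powr_mult_base[of s "- n - 2"] by (simp add: minus_diff_commute)
  moreover have "4 * s * (n * (n + 1) * s powr (- n - 2)) = 4 * n * (n + 1) * (s * s powr (- n - 2))"
    by simp
  ultimately show "2 * n * (- n * s powr (- n - 1)) + 4 * s * (n * (n + 1) * s powr (- n - 2))
           = n * (2 * n + 4) * s powr (- n - 1)"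
    by (simp add: algebra_simps)
qed

text \<open>Comparison from below on the annulus between radii \<open>\<rho>\<close> and
  \<open>R\<close> with a multiple of |y - x|^(-2n) - R^(-2n). The parameter
  \<open>\<epsilon>\<close> measures the distance to the outer sphere: \<open>\<epsilon> = 1\<close>
  covers the half ball, while small \<open>\<epsilon>\<close> gives linear growth away from the
  outer sphere, as in Hopf's lemma. The open ball alone has to lie in \<open>S\<close>, so the outer
  sphere may touch the boundary.\<close>

lemma superharmonic_propagation:
  fixes u :: "'a::euclidean_space \<Rightarrow> real"
  assumes S: "open S" "C2_on S u" "\<And>y. y \<in> S \<Longrightarrow> laplacian u y < 0"
    and cont: "continuous_on (cball x R) u" and nn: "\<And>y. y \<in> cball x R \<Longrightarrow> 0 \<le> u y"
    and sub: "ball x R \<subseteq> S" and \<rho>: "0 < \<rho>" "\<rho> < R" and m: "m > 0"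
    and um: "\<And>y. y \<in> cball x \<rho> \<Longrightarrow> m \<le> u y"
    and \<epsilon>: "0 \<le> \<epsilon>" "\<epsilon> \<le> 1" and y: "(1 + \<epsilon>) * (norm (y - x))\<^sup>2 \<le> R\<^sup>2"
  shows "m * \<epsilon> * (\<rho> / R) ^ (2 * DIM('a)) \<le> u y"
proof (cases "y \<in> cball x \<rho>")
  case True
  have "\<epsilon> * (\<rho> / R) ^ (2 * DIM('a)) \<le> 1 * 1"
    using \<epsilon> \<rho> by (intro mult_mono power_le_one) auto
  then have "m * \<epsilon> * (\<rho> / R) ^ (2 * DIM('a)) \<le> m" using m by (simp add: mult.assoc)
  then show ?thesis using um[OF True] by simp
next
  case False
  define n where "n = real DIM('a)"
  have n: "n \<ge> 1" by (simp add: n_def Suc_le_eq)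
  \<comment> \<open>Normalised so that the barrier is at most \<open>m\<close> on the inner sphere;
    it vanishes on the outer one.\<close>
  define k where "k = m * (\<rho>\<^sup>2) powr n"
  have k: "k > 0" using m \<rho> by (simp add: k_def)
  define F where "F s = k * (s powr (- n) - (R\<^sup>2) powr (- n))" for s
  define F' where "F' s = k * (- n * s powr (- n - 1))" for s
  define F'' where "F'' s = k * (n * (n + 1) * s powr (- n - 2))" for s
  have dF: "(F has_real_derivative F' s) (at s)" if "s > 0" for s
    unfolding F_def F'_def
    using DERIV_cmult[OF DERIV_diff[OF inverse_power_radial(1)[OF that] DERIV_const]] by simp
  have dF': "(F' has_real_derivative F'' s) (at s)" if "s > 0" for s
    unfolding F'_def F''_def by (rule DERIV_cmult[OF inverse_power_radial(2)[OF that]])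
  define Q where "Q = cball x R - ball x \<rho>"
  have pos: "norm (z - x) \<ge> \<rho>" "(norm (z - x))\<^sup>2 > 0" if "z \<in> Q" for z
    using that \<rho> by (auto simp: Q_def dist_norm norm_minus_commute)
  have "norm (y - x) \<le> R"
  proof -
    have "(norm (y - x))\<^sup>2 \<le> (1 + \<epsilon>) * (norm (y - x))\<^sup>2" using \<epsilon> by (simp add: mult_right_le_one_le algebra_simps)
    then have "(norm (y - x))\<^sup>2 \<le> R\<^sup>2" using y by simp
    then show ?thesis using \<rho> by (intro power2_le_imp_le[of "norm (y - x)" R]) auto
  qed
  then have yQ: "y \<in> Q" using False by (auto simp: Q_def dist_norm norm_minus_commute)
  have "-1 * u y \<le> -1 * F ((norm (y - x))\<^sup>2)"
  proof (rule radial_comparison[where Q = Q and S = S and F' = F' and F'' = F''])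
    show "compact Q" unfolding Q_def by (intro compact_diff) auto
    show "continuous_on Q u" using cont by (rule continuous_on_subset) (auto simp: Q_def)
    show "continuous_on Q (\<lambda>y. F ((norm (y - x))\<^sup>2))"
      unfolding F_def using pos(2) by (intro continuous_intros) fastforce+
    fix z s assume z: "z \<in> Q" and s: "s = (norm (z - x))\<^sup>2" and "-1 * F s < -1 * u z"
    then have lt: "u z < F s" by simp
    have zR: "z \<in> cball x R" using z by (simp add: Q_def)
    have s0: "s > 0" using pos[OF z] s by simp
    have 1: "norm (z - x) \<noteq> R"
      using lt nn[OF zR] by (auto simp: s F_def)
    have 2: "norm (z - x) \<noteq> \<rho>"
    proof
      assume a: "norm (z - x) = \<rho>"
      have "F s \<le> k * s powr (- n)" using k by (simp add: F_def)
      also have "\<dots> = m" using a \<rho> unfolding k_def s by (simp add: powr_minus)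
      finally show False using lt um[of z] a by (simp add: dist_norm norm_minus_commute)
    qed
    have zb: "z \<in> ball x R - cball x \<rho>" using 1 2 z by (auto simp: Q_def dist_norm norm_minus_commute)
    have "ball x R - cball x \<rho> \<subseteq> interior Q" unfolding Q_def by (intro interior_maximal) auto
    then have int: "z \<in> interior Q" using zb by blast
    have "2 * n * F' s + 4 * s * F'' s = k * (n * (2 * n + 4) * s powr (- n - 1))"
      unfolding inverse_power_radial(3)[OF s0, symmetric] F'_def F''_def by (simp add: algebra_simps)
    moreover have "k * (n * (2 * n + 4) * s powr (- n - 1)) \<ge> 0" using k n by simp
    moreover have zS: "z \<in> S" using zb sub by auto
    moreover have "\<forall>\<^sub>F s in nhds s. (F has_real_derivative F' s) (at s)"
      using s0 dF by (auto simp: eventually_nhds intro!: exI[of _ "{0<..}"])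
    ultimately show "z \<in> interior Q \<and> z \<in> S \<and> (\<forall>\<^sub>F s in nhds s. (F has_real_derivative F' s) (at s)) \<and>
        (F' has_real_derivative F'' s) (at s) \<and>
        -1 * (2 * real DIM('a) * F' s + 4 * s * F'' s) < -1 * laplacian u z"
      using int dF'[OF s0] S(3)[OF zS] by (simp add: n_def)
  qed (use S yQ in auto)
  then have uy: "k * (((norm (y - x))\<^sup>2) powr (- n) - (R\<^sup>2) powr (- n)) \<le> u y" by (simp add: F_def)
  define s where "s = (norm (y - x))\<^sup>2"
  have s: "s > 0" using pos[OF yQ] by (simp add: s_def)
  \<comment> \<open>The power n of \<open>1 + \<epsilon>\<close> is at least
    \<open>1 + \<epsilon>\<close> because \<open>n \<ge> 1\<close>, so the difference in the barrier
    keeps a fraction \<open>\<epsilon>\<close>.\<close>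
  have "(1 + \<epsilon>) * (R\<^sup>2) powr (- n) \<le> s powr (- n)"
  proof -
    have "s \<le> R\<^sup>2 / (1 + \<epsilon>)" using y \<epsilon> by (simp add: s_def field_simps)
    then have "(R\<^sup>2 / (1 + \<epsilon>)) powr (- n) \<le> s powr (- n)"
      using s n by (intro powr_mono2') auto
    moreover have "(R\<^sup>2 / (1 + \<epsilon>)) powr (- n) = (R\<^sup>2) powr (-n) * (1 + \<epsilon>) powr n"
      using \<epsilon> \<rho> by (simp add: powr_divide powr_minus field_simps)
    moreover have "(1 + \<epsilon>) powr 1 \<le> (1 + \<epsilon>) powr n" using n \<epsilon> by (intro powr_mono) auto
    then have "(R\<^sup>2) powr (-n) * (1 + \<epsilon>) \<le> (R\<^sup>2) powr (-n) * (1 + \<epsilon>) powr n"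
      using \<epsilon> by (intro mult_left_mono) auto
    ultimately show ?thesis by (simp add: mult.commute)
  qed
  then have "k * (\<epsilon> * (R\<^sup>2) powr (- n)) \<le> k * (s powr (- n) - (R\<^sup>2) powr (- n))"
    using k by (intro mult_left_mono) (auto simp: algebra_simps)
  moreover have "k * (\<epsilon> * (R\<^sup>2) powr (- n)) = m * \<epsilon> * (\<rho> / R) ^ (2 * DIM('a))"
    using \<rho> unfolding k_def n_def
    by (simp add: powr_minus powr_realpow field_simps power_divide) (simp add: mult.commute flip: power_mult)
  ultimately show ?thesis using uy by (simp add: s_def)
qed

text \<open>Let R be the reflection in the hyperplane through \<open>z\<close> orthogonal to
  \<open>b\<close>. The difference of \<open>u\<close> and its reflection vanishes on that
  hyperplane and is at most \<open>M\<close> in absolute value, so a barrier on the half ball bounds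
  it linearly in the distance \<open>s\<close> to the hyperplane.\<close>

lemma two_point_estimate:
  fixes u :: "'a::euclidean_space \<Rightarrow> real"
  assumes S: "open S" "C2_on S u" and sub: "cball z d \<subseteq> S" and d: "d > 0"
    and b: "b \<in> Basis" and f: "f > 0"
    and u: "\<And>y. y \<in> cball z d \<Longrightarrow> 0 \<le> u y \<and> u y \<le> M \<and> - f \<le> laplacian u y \<and> laplacian u y \<le> 0"
    and s: "0 \<le> s" "s \<le> d"
  shows "\<bar>u (z + s *\<^sub>R b) - u (z - s *\<^sub>R b)\<bar> \<le> s * ((real DIM('a) + 1) * M / d + f * d)"
proof -
  define n where "n = real DIM('a)"
  have n: "n \<ge> 1" by (simp add: n_def Suc_le_eq)
  have M: "M \<ge> 0" using u[of z] d by force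
  define \<tau> where "\<tau> y = (y - z) \<bullet> b" for y
  define R where "R y = y - (2 * \<tau> y) *\<^sub>R b" for y
  \<comment> \<open>The first bracket is harmonic, since the 2n from the squared norm cancels
    against n times -2, and its term is at least \<open>M\<close> on the sphere of radius d. The
    last term has Laplacian \<open>- 2 * f\<close> and absorbs the right-hand side. On the
    hyperplane \<open>\<psi>\<close> is nonnegative.\<close>
  define \<psi> where "\<psi> y = M / d\<^sup>2 * ((norm (y - z))\<^sup>2 + n * (\<tau> y * (d - \<tau> y))) + f * (\<tau> y * (d - \<tau> y))" for y
  define Q where "Q = cball z d \<inter> {y. \<tau> y \<ge> 0}"
  have bb: "b \<bullet> b = 1" using b by simp
  have normR: "norm (R y - z) = norm (y - z)" for y
  proof -
    have "(norm (R y - z))\<^sup>2 = (norm (y - z))\<^sup>2"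
      unfolding power2_norm_eq_inner R_def \<tau>_def
      using bb by (simp add: inner_simps algebra_simps inner_commute)
    then show ?thesis by simp
  qed
  have RQ: "R y \<in> cball z d" if "y \<in> Q" for y
    using that normR[of y] by (auto simp: Q_def dist_norm norm_minus_commute)
  have \<tau>d: "\<tau> y \<le> d" if "y \<in> Q" for y
  proof -
    have "\<tau> y \<le> norm (y - z) * norm b" unfolding \<tau>_def by (rule norm_cauchy_schwarz)
    then show ?thesis using that b by (simp add: Q_def dist_norm norm_minus_commute)
  qed
  have zs: "z + s *\<^sub>R b \<in> Q"
    using s b bb by (simp add: Q_def \<tau>_def dist_norm inner_simps)
  have cu: "continuous_on (cball z d) u"
    using S sub continuous_on_subset unfolding C2_on_def C1_on_def by blast
  have c\<tau>: "continuous_on A \<tau>" for A unfolding \<tau>_def by (intro continuous_intros)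
  have cR: "continuous_on A R" for A unfolding R_def by (intro continuous_intros c\<tau>)
  have main: "\<sigma> * (u (z + s *\<^sub>R b) - u (R (z + s *\<^sub>R b))) - \<psi> (z + s *\<^sub>R b) \<le> 0" if \<sigma>: "\<sigma> = 1 \<or> \<sigma> = -1" for \<sigma> :: real
  proof (rule max_principle[where Q = Q and H = "\<lambda>y. \<sigma> * (u y - u (R y)) - \<psi> y"])
    show "compact Q" unfolding Q_def
      by (intro compact_Int_closed closed_Collect_le continuous_intros c\<tau>) auto
    have "continuous_on Q u" using cu by (rule continuous_on_subset) (auto simp: Q_def)
    moreover have "continuous_on Q (\<lambda>y. u (R y))"
      using cR by (rule continuous_on_compose2[OF cu]) (use RQ in auto)
    ultimately show "continuous_on Q (\<lambda>y. \<sigma> * (u y - u (R y)) - \<psi> y)"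
      unfolding \<psi>_def by (intro continuous_intros c\<tau>)
    fix y assume y: "y \<in> Q" and gt: "\<sigma> * (u y - u (R y)) - \<psi> y > 0"
    have yc: "y \<in> cball z d" "\<tau> y \<ge> 0" using y by (auto simp: Q_def)
    have tt: "\<tau> y * (d - \<tau> y) \<ge> 0" using yc \<tau>d[OF y] by simp
    have uy: "\<sigma> * (u y - u (R y)) \<le> M"
      using u[OF yc(1)] u[OF RQ[OF y]] \<sigma> by auto
    have "\<tau> y \<noteq> 0"
    proof
      assume 0: "\<tau> y = 0"
      then have "R y = y" "\<psi> y \<ge> 0" using M by (auto simp: R_def \<psi>_def)
      then show False using gt by simp
    qed
    moreover have "norm (y - z) \<noteq> d"
    proof
      assume a: "norm (y - z) = d"
      have "M = M / d\<^sup>2 * d\<^sup>2" using d by simp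
      also have "\<dots> \<le> M / d\<^sup>2 * ((norm (y - z))\<^sup>2 + n * (\<tau> y * (d - \<tau> y)))"
        using M tt n a by (intro mult_left_mono) auto
      also have "\<dots> \<le> \<psi> y" using f tt by (simp add: \<psi>_def)
      finally show False using gt uy by simp
    qed
    ultimately have "y \<in> ball z d \<inter> {y. \<tau> y > 0}"
      using yc by (auto simp: dist_norm norm_minus_commute)
    moreover have "ball z d \<inter> {y. \<tau> y > 0} \<subseteq> interior Q"
      unfolding Q_def by (intro interior_maximal open_Int open_Collect_less continuous_intros c\<tau>) auto
    ultimately have int: "y \<in> interior Q" by blast
    define D where "D b' = \<sigma> * (partial_deriv b' (partial_deriv b' u) y - partial_deriv b' (partial_deriv b' u) (R y))
        - (M / d\<^sup>2 * (2 + n * (if b' = b then -2 else 0)) + f * (if b' = b then -2 else 0))" for b'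
    have "second_deriv0 (\<lambda>s. \<sigma> * (u (y + s *\<^sub>R b') - u (R (y + s *\<^sub>R b'))) - \<psi> (y + s *\<^sub>R b')) (D b')"
      if b': "b' \<in> Basis" for b'
    proof -
      have \<tau>s: "\<tau> (y + s *\<^sub>R b') = (if b' = b then \<tau> y + s else \<tau> y)" for s
        using b b' by (simp add: \<tau>_def inner_simps inner_Basis)
      \<comment> \<open>Moving in direction \<open>b\<close> moves the reflected point backwards,
        which leaves second derivatives unchanged; in the other directions both points move in
        parallel.\<close>
      have 1: "second_deriv0 (\<lambda>s. u (R (y + s *\<^sub>R b'))) (partial_deriv b' (partial_deriv b' u) (R y))"
      proof (cases "b' = b")
        case True
        have "R (y + s *\<^sub>R b') = R y + (- s) *\<^sub>R b'" for s
          using True unfolding R_def \<tau>s by (simp add: algebra_simps flip: scaleR_add_left)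
        then show ?thesis
          using second_deriv0_flip[OF second_deriv0_C2[OF S _ b', of "R y"]] RQ[OF y] sub by auto
      next
        case False
        have "R (y + s *\<^sub>R b') = R y + s *\<^sub>R b'" for s
          using False unfolding R_def \<tau>s by (simp add: algebra_simps)
        then show ?thesis
          using second_deriv0_C2[OF S _ b', of "R y"] RQ[OF y] sub by auto
      qed
      have 2: "second_deriv0 (\<lambda>s. \<tau> (y + s *\<^sub>R b') * (d - \<tau> (y + s *\<^sub>R b'))) (if b' = b then -2 else 0)"
        unfolding \<tau>s second_deriv0_def
        by (intro exI[of _ "\<lambda>s. if b' = b then d - 2 * \<tau> y - 2 * s else 0"])
          (auto intro!: always_eventually derivative_eq_intros)
      have 3: "second_deriv0 (\<lambda>s. (norm (y + s *\<^sub>R b' - z))\<^sup>2) 2"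
        using second_deriv0_radial[OF b', of _ y z "\<lambda>s. s" "\<lambda>_. 1" 0] by auto
      have "y \<in> S" using yc sub by auto
      then show ?thesis unfolding \<psi>_def D_def
        by (intro second_deriv0_diff second_deriv0_add second_deriv0_cmult second_deriv0_C2[OF S] b' 1 2 3)
    qed
    \<comment> \<open>Both Laplacians lie between \<open>- f\<close> and 0, so their difference is
      at least \<open>- f\<close>, and the surplus \<open>2 * f\<close> from the barrier makes the
      sum positive.\<close>
    moreover have "sum D Basis = \<sigma> * (laplacian u y - laplacian u (R y)) + 2 * f"
    proof -
      have 1: "(\<Sum>b'\<in>Basis. if b' = b then -2 else 0 :: real) = -2" using b by simp
      have 2: "sum (\<lambda>b'. 2) (Basis :: 'a set) = 2 * n" by (simp add: n_def)
      have "sum D Basis = \<sigma> * (laplacian u y - laplacian u (R y)) -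
         (M / d\<^sup>2 * (2 * n + n * (-2)) + f * (-2))"
        unfolding D_def laplacian_def sum_subtractf sum.distrib sum_distrib_left[symmetric] 1 2 ..
      then show ?thesis by simp
    qed
    moreover have "\<sigma> * (laplacian u y - laplacian u (R y)) \<ge> - f"
      using u[OF yc(1)] u[OF RQ[OF y]] \<sigma> by auto
    ultimately show "y \<in> interior Q \<and>
      (\<exists>D. (\<forall>b\<in>Basis. second_deriv0 (\<lambda>s. \<sigma> * (u (y + s *\<^sub>R b) - u (R (y + s *\<^sub>R b))) - \<psi> (y + s *\<^sub>R b)) (D b)) \<and> sum D Basis > 0)"
      using int f by (intro conjI exI[of _ D]) auto
  qed (rule zs)
  have \<tau>z: "\<tau> (z + s *\<^sub>R b) = s" using bb by (simp add: \<tau>_def)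
  have Rz: "R (z + s *\<^sub>R b) = z - s *\<^sub>R b" unfolding R_def \<tau>z by (simp add: algebra_simps flip: scaleR_add_left)
  have "\<psi> (z + s *\<^sub>R b) \<le> s * ((n + 1) * M / d + f * d)"
  proof -
    have "s\<^sup>2 + n * (s * (d - s)) \<le> s * d + n * (s * d)"
      using s n unfolding power2_eq_square by (intro add_mono mult_left_mono) auto
    then have "M / d\<^sup>2 * (s\<^sup>2 + n * (s * (d - s))) \<le> M / d\<^sup>2 * (s * d + n * (s * d))"
      using M by (intro mult_left_mono) auto
    also have "\<dots> = s * ((n + 1) * M / d)" using d by (simp add: power2_eq_square field_simps)
    moreover have "f * (s * (d - s)) \<le> f * (s * d)" using f s by (intro mult_left_mono) auto
    ultimately show ?thesis using b unfolding \<psi>_def \<tau>z by (simp add: algebra_simps)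
  qed
  then show ?thesis using main[of 1] main[of "-1"] by (simp add: Rz n_def)
qed


text \<open>The lower bound on \<open>u\<close> bounds \<open>u powr (- \<gamma>)\<close>, so
  two-point estimates in the coordinate directions give a Lipschitz constant of order
  \<open>u x / \<rho>\<close>. A sufficiently small multiple of \<open>\<rho>\<close> then keeps the
  oscillation below half of \<open>u x\<close>.\<close>

lemma interior_half_bound:
  fixes \<gamma> B :: real
  assumes \<gamma>: "\<gamma> > 1" and B: "B \<ge> 1"
  shows "\<exists>\<delta>. 0 < \<delta> \<and> \<delta> \<le> 1/4 \<and> (\<forall>S (u :: 'a::euclidean_space \<Rightarrow> real) x \<rho>.
     lane_emden_on \<gamma> S u \<longrightarrow> cball x \<rho> \<subseteq> S \<longrightarrow> 0 < \<rho> \<longrightarrow> (\<forall>y\<in>cball x \<rho>. u y \<le> B * u x) \<longrightarrow>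
     (\<forall>y\<in>cball x (\<delta> * \<rho>). u x / 2 \<le> u y))"
proof -
  define \<phi> where "\<phi> = 2 / (1 + \<gamma>)"
  note ph = phi_exponents[OF \<gamma> \<phi>_def]
  define n where "n = real DIM('a)"
  have n: "n \<ge> 1" by (simp add: n_def Suc_le_eq)
  \<comment> \<open>Points within three quarters of \<open>\<rho>\<close> from \<open>x\<close> are
    centres of balls of radius \<open>\<rho> / 4\<close> inside \<open>S\<close>; this is the
    constant of the lower bound there.\<close>
  define c where "c = (1/4) powr \<phi> / (4 * n)"
  have c: "c > 0" using n by (simp add: c_def)
  \<comment> \<open>\<open>A * u x / \<rho>\<close> will bound the difference quotients: the first
    summand comes from the supremum \<open>B * u x\<close> on balls of radius
    \<open>\<rho> / 2\<close>, the second from the right-hand side. Then \<open>\<delta>\<close> is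
    chosen so that n steps, each changing \<open>u\<close> by at most
    \<open>\<delta> / 2 * A * u x\<close>, cost \<open>u x / 16\<close>.\<close>
  define A where "A = 2 * (n + 1) * B + c powr (- \<gamma> - 1)"
  have A: "A \<ge> 1"
  proof -
    have "2 * (n + 1) * B \<ge> 1 * 1" using n B by (intro mult_mono) auto
    moreover have "c powr (- \<gamma> - 1) \<ge> 0" by simp
    ultimately show ?thesis unfolding A_def by linarith
  qed
  define \<delta> where "\<delta> = 1 / (8 * n * A)"
  have \<delta>: "\<delta> > 0" using n A by (simp add: \<delta>_def)
  have nA: "n * A \<ge> 1" using mult_mono[of 1 n 1 A] n A by simp
  have n\<delta>: "n * \<delta> \<le> 1/8" "\<delta> \<le> 1/8" using n A nA by (simp_all add: \<delta>_def field_simps)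
  show ?thesis
  proof (intro exI[of _ \<delta>] conjI allI impI ballI)
    fix S and u :: "'a \<Rightarrow> real" and x y \<rho>
    assume u: "lane_emden_on \<gamma> S u" and sub: "cball x \<rho> \<subseteq> S" and \<rho>: "0 < \<rho>"
      and ub: "\<forall>y\<in>cball x \<rho>. u y \<le> B * u x" and y: "y \<in> cball x (\<delta> * \<rho>)"
    have uS: "open S" "C2_on S u" "\<And>y. y \<in> S \<Longrightarrow> 0 < u y" "\<And>y. y \<in> S \<Longrightarrow> - laplacian u y = u y powr (- \<gamma>)"
      using u by (auto simp: lane_emden_on_def)
    define f where "f = (c * \<rho> powr \<phi>) powr (- \<gamma>)"
    have f: "f > 0" using c \<rho> by (simp add: f_def)
    have low: "c * \<rho> powr \<phi> \<le> u w" if "dist x w \<le> 3/4 * \<rho>" for w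
    proof -
      have "cball w (\<rho> / 4) \<subseteq> S"
      proof
        fix v assume "v \<in> cball w (\<rho> / 4)"
        then have "dist x v \<le> \<rho>" using that dist_triangle[of x v w] by simp
        then show "v \<in> S" using sub by auto
      qed
      then have "(\<rho> / 4) powr \<phi> / (4 * n) \<le> u w"
        using interior_lower_bound[OF \<gamma> \<phi>_def u, of w "\<rho> / 4"] \<rho> by (simp add: n_def)
      then show ?thesis using \<rho> by (simp add: c_def powr_divide)
    qed
    have ux: "u x > 0" using uS(3)[of x] sub \<rho> by (meson centre_in_cball less_imp_le subsetD)
    \<comment> \<open>By scaling, \<open>f * \<rho>\<^sup>2\<close> is a multiple of
      \<open>\<rho> powr \<phi>\<close>, which the lower bound at \<open>x\<close> turns into a
      multiple of \<open>u x\<close>.\<close>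
    have fd: "f * (\<rho> / 2) \<le> c powr (- \<gamma> - 1) * u x / \<rho>"
    proof -
      have "f * \<rho> * \<rho> = c powr (-\<gamma>) * \<rho> powr \<phi>"
        unfolding f_def powr_phi_neg_gamma[OF \<gamma> \<phi>_def c \<rho>]
        using \<rho> by (simp add: powr_diff powr_numeral power2_eq_square)
      also have "\<dots> = c powr (-\<gamma> - 1) * (c * \<rho> powr \<phi>)" using c by (simp add: powr_diff)
      also have "\<dots> \<le> c powr (-\<gamma> - 1) * u x" using low[of x] \<rho> by (intro mult_left_mono) auto
      finally have "f * \<rho> \<le> c powr (-\<gamma> - 1) * u x / \<rho>" using \<rho> by (simp add: field_simps)
      moreover have "f * (\<rho> / 2) \<le> f * \<rho>" using f \<rho> by simp
      ultimately show ?thesis by linarith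
    qed
    have step: "\<bar>u (z + s *\<^sub>R b) - u (z - s *\<^sub>R b)\<bar> \<le> s * (A * u x / \<rho>)"
      if "dist x z \<le> \<rho> / 4" "b \<in> Basis" "0 \<le> s" "s \<le> \<rho> / 2" for z b s
    proof -
      have in34: "dist x w \<le> 3/4 * \<rho>" if "w \<in> cball z (\<rho>/2)" for w
        using that dist_triangle[of x w z] \<open>dist x z \<le> \<rho> / 4\<close> by simp
      have "\<bar>u (z + s *\<^sub>R b) - u (z - s *\<^sub>R b)\<bar> \<le> s * ((real DIM('a) + 1) * (B * u x) / (\<rho> / 2) + f * (\<rho> / 2))"
      proof (rule two_point_estimate[OF uS(1,2)])
        show "cball z (\<rho> / 2) \<subseteq> S" using in34 sub \<rho> by force
        fix w assume w: "w \<in> cball z (\<rho> / 2)"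
        have wx: "w \<in> cball x \<rho>" using in34[OF w] \<rho> by simp
        then have wS: "w \<in> S" using sub by auto
        have "u w powr (- \<gamma>) \<le> f" unfolding f_def
          using low[OF in34[OF w]] c \<rho> \<gamma> by (intro powr_mono2') auto
        then show "0 \<le> u w \<and> u w \<le> B * u x \<and> - f \<le> laplacian u w \<and> laplacian u w \<le> 0"
          using uS(3,4)[OF wS] ub wx lane_emden_laplacian_neg[OF u wS] by auto
      qed (use that \<rho> f in auto)
      also have "\<dots> \<le> s * (A * u x / \<rho>)"
        using fd that \<rho> by (intro mult_left_mono) (auto simp: A_def n_def field_simps)
      finally show ?thesis .
    qed
    define v where "v = y - x"
    have v: "norm v \<le> \<delta> * \<rho>" using y by (simp add: v_def dist_norm norm_minus_commute)
    \<comment> \<open>A path from \<open>x\<close> to \<open>y\<close> that changes one coordinate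
      at a time. Consecutive points are symmetric about their midpoint, as the two-point estimate
      demands; hence the half step \<open>h\<close> below.\<close>
    define X where "X T = x + (\<Sum>b\<in>T. (v \<bullet> b) *\<^sub>R b)" for T
    have dX: "dist x (X T) \<le> \<rho> / 8" if "T \<subseteq> Basis" for T
    proof -
      have "dist x (X T) = norm (\<Sum>b\<in>T. (v \<bullet> b) *\<^sub>R b)" by (simp add: X_def dist_norm)
      also have "\<dots> \<le> (\<Sum>b\<in>T. \<delta> * \<rho>)"
      proof (rule sum_norm_le)
        fix b assume "b \<in> T"
        then have "b \<in> Basis" using that by auto
        then show "norm ((v \<bullet> b) *\<^sub>R b) \<le> \<delta> * \<rho>" using v Basis_le_norm[of b v] by simp
      qed
      also have "\<dots> \<le> n * (\<delta> * \<rho>)" using card_mono[OF _ that] \<delta> \<rho> by (simp add: n_def)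
      also have "\<dots> \<le> \<rho> / 8" using n\<delta>(1) \<rho> mult_right_mono[of "n * \<delta>" "1/8" \<rho>] by simp
      finally show ?thesis .
    qed
    have tel: "u x - u (X T) \<le> card T * (\<delta> / 2 * A * u x)" if "T \<subseteq> Basis" for T
      using finite_subset[OF that finite_Basis] that
    proof (induction T rule: finite_induct)
      case empty then show ?case by (simp add: X_def)
    next
      case (insert b T)
      then have bT: "b \<in> Basis" "T \<subseteq> Basis" by auto
      define h where "h = (v \<bullet> b) / 2"
      have h: "\<bar>h\<bar> \<le> \<delta> / 2 * \<rho>" using v Basis_le_norm[OF bT(1), of v] by (simp add: h_def)
      have h2: "\<bar>h\<bar> \<le> \<rho> / 16" using h mult_right_mono[OF n\<delta>(2), of \<rho>] \<rho> by linarith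
      define z where "z = X T + h *\<^sub>R b"
      have XI: "X (insert b T) = z + h *\<^sub>R b" "X T = z - h *\<^sub>R b"
        using insert by (simp_all add: X_def z_def h_def algebra_simps flip: scaleR_add_left)
      have "dist x z \<le> dist x (X T) + dist (X T) z" by (rule dist_triangle)
      also have "dist (X T) z = \<bar>h\<bar>" using bT by (simp add: z_def dist_norm)
      finally have dz: "dist x z \<le> \<rho> / 4" using dX[OF bT(2)] h2 \<rho> by simp
      have "\<bar>u (z + \<bar>h\<bar> *\<^sub>R b) - u (z - \<bar>h\<bar> *\<^sub>R b)\<bar> \<le> \<bar>h\<bar> * (A * u x / \<rho>)"
        using h2 \<rho> by (intro step dz bT) auto
      moreover have "\<bar>u (z + \<bar>h\<bar> *\<^sub>R b) - u (z - \<bar>h\<bar> *\<^sub>R b)\<bar> = \<bar>u (z + h *\<^sub>R b) - u (z - h *\<^sub>R b)\<bar>"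
        by (cases "h \<ge> 0") (auto simp: abs_minus_commute)
      moreover have "\<bar>h\<bar> * (A * u x / \<rho>) \<le> \<delta> / 2 * \<rho> * (A * u x / \<rho>)"
        using h A ux \<rho> by (intro mult_right_mono) auto
      moreover have "\<delta> / 2 * \<rho> * (A * u x / \<rho>) = \<delta> / 2 * A * u x" using \<rho> by simp
      ultimately have "u (X T) - u (X (insert b T)) \<le> \<delta> / 2 * A * u x" unfolding XI by linarith
      then show ?case using insert by (simp add: algebra_simps)
    qed
    have "X Basis = y" unfolding X_def euclidean_representation by (simp add: v_def)
    then have "u x - u y \<le> n * (\<delta> / 2 * A * u x)" using tel[of Basis] by (simp add: n_def)
    also have "\<dots> = u x / 16" using n A by (simp add: \<delta>_def)
    finally show "u x / 2 \<le> u y" using ux by simp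
  qed (use \<delta> n\<delta> in auto)
qed

section \<open>Decay at the boundary\<close>

lemma C2_on_subset: "C2_on S u \<Longrightarrow> T \<subseteq> S \<Longrightarrow> C2_on T u"
  unfolding C2_on_def C1_on_def by (meson continuous_on_subset subsetD)

lemma norm_fst_le_norm: "norm (fst z) \<le> norm z"
  and norm_snd_le_norm: "norm (snd z) \<le> norm z"
  by (cases z; simp add: norm_fst_le norm_snd_le)+

text \<open>The information about the graph that the estimates use. The quadratic bound stands in
  for the two tangent balls at the origin; the constant 4000 makes \<open>g\<close> at most 1/10 in
  absolute value on the whole ball of radius 20.\<close>

locale flat_solution =
  fixes \<gamma> L :: real and g :: "real ^ 'm \<Rightarrow> real" and u :: "(real ^ 'm) \<times> real \<Rightarrow> real"
  assumes \<gamma>: "\<gamma> > 1" and L: "L > 0"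
    and lip: "\<And>x y. x \<in> ball 0 20 \<Longrightarrow> y \<in> ball 0 20 \<Longrightarrow> \<bar>g x - g y\<bar> \<le> L * norm (x - y)"
    and flat: "\<And>x. x \<in> ball 0 20 \<Longrightarrow> \<bar>g x\<bar> \<le> (norm x)\<^sup>2 / 4000"
    and sol: "is_solution \<gamma> g 20 u"
begin

definition height :: "(real ^ 'm) \<times> real \<Rightarrow> real" where
  "height y = snd y - g (fst y)"

definition \<Omega> :: "((real ^ 'm) \<times> real) set" where
  "\<Omega> = {y. norm (fst y) < 20 \<and> 0 < height y \<and> height y < 20}"

lemma flat': "norm x < 20 \<Longrightarrow> \<bar>g x\<bar> \<le> 1/10"
proof -
  assume "norm x < 20"
  then have "(norm x)\<^sup>2 \<le> 20\<^sup>2" by (intro power_mono) auto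
  then show ?thesis using flat[of x] \<open>norm x < 20\<close> by auto
qed

lemma continuous_height: "continuous_on (ball 0 20 \<times> UNIV) height"
proof -
  have "L-lipschitz_on (ball 0 20) g"
    using lip L by (auto simp: lipschitz_on_def dist_norm dist_real_def)
  then have "continuous_on (ball 0 20) g" by (rule lipschitz_on_continuous_on)
  then have "continuous_on (ball 0 20 \<times> (UNIV :: real set)) (\<lambda>y. g (fst y))"
    by (rule continuous_on_compose2) (auto intro!: continuous_intros)
  then show ?thesis unfolding height_def by (intro continuous_intros)
qed

lemma open_\<Omega>: "open \<Omega>"
proof -
  have "\<Omega> = (ball 0 20 \<times> UNIV) \<inter> height -` {0<..<20}" by (auto simp: \<Omega>_def)
  then show ?thesis
    using continuous_open_preimage[OF continuous_height, of "{0<..<20}"] by (simp add: open_Times)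
qed

lemma \<Omega>_interior: "\<Omega> \<subseteq> interior (grounded_cylinder g 20)"
  by (rule interior_maximal[OF _ open_\<Omega>]) (auto simp: \<Omega>_def grounded_cylinder_def height_def)

lemma lane_emden: "lane_emden_on \<gamma> \<Omega> u"
  using sol \<Omega>_interior open_\<Omega> interior_subset[of "grounded_cylinder g 20"]
  unfolding lane_emden_on_def is_solution_def
  by (auto intro: C2_on_subset simp: \<Omega>_def height_def subset_iff)

lemmas \<Omega>_props = lane_emden[unfolded lane_emden_on_def]

text \<open>Radius 19 stays clear of the lateral and top boundary, where nothing is assumed about
  \<open>u\<close>: the height is at most 19 + 1/10, below 20.\<close>

lemma \<Omega>I: "norm y \<le> 19 \<Longrightarrow> 0 < height y \<Longrightarrow> y \<in> \<Omega>"
proof -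
  assume y: "norm y \<le> 19" "0 < height y"
  have "norm (fst y) \<le> 19" "\<bar>snd y\<bar> \<le> 19"
    using norm_fst_le_norm[of y] norm_snd_le_norm[of y] y by auto
  then show ?thesis using y flat'[of "fst y"] by (auto simp: \<Omega>_def height_def)
qed

lemma continuous_u: "(\<And>y. y \<in> A \<Longrightarrow> norm y \<le> 19 \<and> 0 \<le> height y) \<Longrightarrow> continuous_on A u"
proof -
  assume A: "\<And>y. y \<in> A \<Longrightarrow> norm y \<le> 19 \<and> 0 \<le> height y"
  have "continuous_on (interior (grounded_cylinder g 20) \<union> graph_over (ball 0 20) g) u"
    using sol by (simp add: is_solution_def)
  moreover have "A \<subseteq> interior (grounded_cylinder g 20) \<union> graph_over (ball 0 20) g"
  proof
    fix y assume y: "y \<in> A"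
    show "y \<in> interior (grounded_cylinder g 20) \<union> graph_over (ball 0 20) g"
    proof (cases "height y = 0")
      case True
      then show ?thesis using A[OF y] norm_fst_le_norm[of y] by (auto simp: graph_over_def height_def)
    next
      case False
      then show ?thesis using A[OF y] \<Omega>I[of y] \<Omega>_interior by auto
    qed
  qed
  ultimately show ?thesis using continuous_on_subset by blast
qed

lemma u_boundary: "norm y \<le> 19 \<Longrightarrow> height y = 0 \<Longrightarrow> u y = 0"
  using sol norm_fst_le_norm[of y] by (cases y) (auto simp: is_solution_def graph_over_def height_def)

lemma u_pos: "norm y \<le> 19 \<Longrightarrow> 0 < height y \<Longrightarrow> 0 < u y"
  using \<Omega>I \<Omega>_props by auto

lemma u_nonneg: "norm y \<le> 19 \<Longrightarrow> 0 \<le> height y \<Longrightarrow> 0 \<le> u y"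
  using u_pos u_boundary by (metis less_le order_refl)

lemma height_lipschitz:
  assumes "norm x \<le> 19" "norm y \<le> 19"
  shows "\<bar>height x - height y\<bar> \<le> (1 + L) * norm (x - y)"
proof -
  have 1: "\<bar>g (fst x) - g (fst y)\<bar> \<le> L * norm (fst x - fst y)"
    using assms norm_fst_le_norm[of x] norm_fst_le_norm[of y] by (intro lip) auto
  have "norm (fst x - fst y) \<le> norm (x - y)" "\<bar>snd x - snd y\<bar> \<le> norm (x - y)"
    using norm_fst_le_norm[of "x - y"] norm_snd_le_norm[of "x - y"] by auto
  then have "L * norm (fst x - fst y) \<le> L * norm (x - y)" "\<bar>snd x - snd y\<bar> \<le> norm (x - y)"
    using L by auto
  then show ?thesis using 1 by (simp add: height_def algebra_simps)
qed

lemma compact_upper_cball: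
  assumes "\<And>y. y \<in> cball x r \<Longrightarrow> norm y \<le> 19"
  shows "compact (cball x r \<inter> {y. 0 \<le> height y})"
proof -
  have "cball x r \<subseteq> ball 0 20 \<times> UNIV"
  proof
    fix y assume "y \<in> cball x r"
    then show "y \<in> ball 0 20 \<times> UNIV" using assms[of y] norm_fst_le_norm[of y] by (cases y) auto
  qed
  then have "continuous_on (cball x r) height" using continuous_height continuous_on_subset by blast
  then have "closed (cball x r \<inter> height -` {0..})"
    by (intro continuous_closed_preimage) auto
  moreover have "cball x r \<inter> height -` {0..} = cball x r \<inter> {y. 0 \<le> height y}" by auto
  moreover have "bounded (cball x r \<inter> {y. 0 \<le> height y})" by (rule bounded_subset[OF bounded_cball]) auto
  ultimately show ?thesis by (simp add: compact_eq_bounded_closed)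
qed

lemma interior_upper_cball:
  assumes "norm y \<le> 19" "y \<in> ball x r" "0 < height y"
  shows "y \<in> interior (cball x r \<inter> {y. 0 \<le> height y})"
proof -
  have "ball x r \<inter> \<Omega> \<subseteq> interior (cball x r \<inter> {y. 0 \<le> height y})"
    by (rule interior_maximal[OF _ open_Int[OF open_ball open_\<Omega>]]) (auto simp: \<Omega>_def)
  then show ?thesis using assms \<Omega>I[of y] by auto
qed

end

text \<open>The point \<open>p\<close> at depth \<open>r / 4\<close> below \<open>\<xi>\<close> has
  distance at least \<open>\<sigma> * r\<close> from everything above the graph. The barrier is
  \<open>\<alpha>\<close> plus a superharmonic function that increases with the distance to
  \<open>p\<close> and is nonnegative from \<open>\<sigma> * r\<close> on. It exceeds
  \<open>M\<close> on the sphere of radius \<open>r\<close> and is a definite fraction smaller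
  within \<open>r / 4\<close> of \<open>\<xi>\<close>.\<close>

lemma boundary_decay:
  fixes \<gamma> L \<phi> :: real
  assumes \<gamma>: "\<gamma> > 1" and L: "L > 0" and \<phi>: "\<phi> = 2 / (1 + \<gamma>)"
  shows "\<exists>\<theta> A. 0 \<le> \<theta> \<and> \<theta> < 1 \<and> 0 < A \<and>
    (\<forall>(g :: real ^ 'm \<Rightarrow> real) u \<xi> r M. flat_solution \<gamma> L g u \<longrightarrow> 0 < r \<longrightarrow> 0 \<le> M \<longrightarrow>
      norm \<xi> + r \<le> 19 \<longrightarrow> snd \<xi> = g (fst \<xi>) \<longrightarrow>
      (\<forall>y\<in>cball \<xi> r. g (fst y) \<le> snd y \<longrightarrow> u y \<le> M) \<longrightarrow>
      (\<forall>y\<in>cball \<xi> (r/4). g (fst y) \<le> snd y \<longrightarrow> u y \<le> \<theta> * M + A * r powr \<phi>))"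
proof -
  define n where "n = real DIM((real ^ 'm) \<times> real)"
  have n: "n \<ge> 1" by (simp add: n_def)
  define \<sigma> where "\<sigma> = 1 / (4 * (1 + L))"
  have \<sigma>: "0 < \<sigma>" "\<sigma> \<le> 1/4" using L by (auto simp: \<sigma>_def field_simps)
  \<comment> \<open>On the sphere of radius r about \<open>\<xi>\<close> the distance to
    \<open>p\<close> is at least 3r/4, and within \<open>r / 4\<close> of \<open>\<xi>\<close> it is
    at most r/2. So \<open>D\<close> is a lower bound of the normalised barrier on the sphere, the
    numerator of \<open>\<theta>\<close> an upper bound near \<open>\<xi>\<close>.\<close>
  define D where "D = 1 - ((4 * \<sigma> / 3)\<^sup>2) powr n"
  define \<theta> where "\<theta> = (1 - ((2 * \<sigma>)\<^sup>2) powr n) / D"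
  have D: "0 < D" "D \<le> 1"
  proof -
    have "(4 * \<sigma> / 3)\<^sup>2 < 1\<^sup>2" using \<sigma> by (intro power_strict_mono) auto
    then have "((4 * \<sigma> / 3)\<^sup>2) powr n < 1 powr n" using n by (intro powr_less_mono2) auto
    then show "0 < D" by (simp add: D_def)
  qed (simp add: D_def)
  have "(4 * \<sigma> / 3)\<^sup>2 < (2 * \<sigma>)\<^sup>2" using \<sigma> by (intro power_strict_mono) auto
  then have "((4 * \<sigma> / 3)\<^sup>2) powr n < ((2 * \<sigma>)\<^sup>2) powr n" using n by (intro powr_less_mono2) auto
  then have \<theta>1: "\<theta> < 1" using D by (simp add: \<theta>_def D_def)
  have "((2 * \<sigma>)\<^sup>2) powr n \<le> 1 powr n"
    using \<sigma> n power_mono[of "2 * \<sigma>" 1 2] by (intro powr_mono2) auto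
  then have \<theta>0: "0 \<le> \<theta>" using D by (simp add: \<theta>_def)
  \<comment> \<open>Up to the factor \<open>r powr (\<phi> - 2)\<close>, \<open>k0\<close> bounds
    from below how superharmonic the barrier is, using that distances to \<open>p\<close> are at
    most 2r. The choice of \<open>a\<close> gives \<open>1 / a < k0\<close>, so that the equation's
    right-hand side at level \<open>a * r powr \<phi>\<close> is smaller.\<close>
  define k0 where "k0 = (\<sigma>\<^sup>2) powr n * 4 powr (- n - 1)"
  have k0: "k0 > 0" using \<sigma> by (simp add: k0_def)
  define a where "a = 1 / k0 + 1"
  have a: "a > 1" using k0 by (simp add: a_def)
  show ?thesis
  proof (rule exI[of _ \<theta>], rule exI[of _ "a + 1"], intro conjI allI impI ballI)
    fix g :: "real ^ 'm \<Rightarrow> real" and u \<xi> r M y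
    assume fs: "flat_solution \<gamma> L g u" and r: "0 < r" and M: "0 \<le> M" and n\<xi>: "norm \<xi> + r \<le> 19"
      and \<xi>: "snd \<xi> = g (fst \<xi>)" and uM: "\<forall>y\<in>cball \<xi> r. g (fst y) \<le> snd y \<longrightarrow> u y \<le> M"
      and y: "y \<in> cball \<xi> (r/4)" and gy: "g (fst y) \<le> snd y"
    interpret flat_solution \<gamma> L g u by (rule fs)
    have n19: "norm z \<le> 19" if "z \<in> cball \<xi> r" for z
      using that n\<xi> norm_triangle_ineq2[of z \<xi>] by (simp add: dist_norm norm_minus_commute)
    define p where "p = \<xi> - (0, r/4)"
    define Q where "Q = cball \<xi> r \<inter> {y. 0 \<le> height y}"
    \<comment> \<open>The summand \<open>r powr \<phi>\<close> keeps the barrier strictly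
      superharmonic at the required rate even if \<open>M\<close> is small or zero.\<close>
    define M' where "M' = M + r powr \<phi>"
    define \<alpha> where "\<alpha> = a * r powr \<phi>"
    have \<alpha>: "\<alpha> > 0" using a r by (simp add: \<alpha>_def)
    define \<beta> where "\<beta> = M' / D"
    have M': "M' \<ge> r powr \<phi>" "M' > 0" using M r by (auto simp: M'_def add_nonneg_pos)
    have \<beta>: "\<beta> \<ge> r powr \<phi>" "\<beta> > 0"
    proof -
      have "M' * D \<le> M' * 1" using M' D by (intro mult_left_mono) auto
      then have "M' \<le> M' / D" using D by (simp add: field_simps)
      then show "\<beta> \<ge> r powr \<phi>" using M' by (simp add: \<beta>_def)
      show "\<beta> > 0" using M' D by (simp add: \<beta>_def)
    qed
    define k where "k = ((\<sigma> * r)\<^sup>2) powr n"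
    have k: "k > 0" using \<sigma> r by (simp add: k_def)
    define F where "F s = \<alpha> + \<beta> - \<beta> * k * s powr (- n)" for s
    define F' where "F' s = - (\<beta> * k) * (- n * s powr (- n - 1))" for s
    define F'' where "F'' s = - (\<beta> * k) * (n * (n + 1) * s powr (- n - 2))" for s
    have dF: "(F has_real_derivative F' s) (at s)" "(F' has_real_derivative F'' s) (at s)"
      "2 * n * F' s + 4 * s * F'' s = - (\<beta> * k) * (n * (2 * n + 4) * s powr (- n - 1))" if "s > 0" for s
    proof -
      show "(F has_real_derivative F' s) (at s)"
        unfolding F_def F'_def using inverse_power_radial(1)[OF that, of n] that
        by (auto intro!: derivative_eq_intros)
      show "(F' has_real_derivative F'' s) (at s)"
        unfolding F'_def F''_def by (rule DERIV_cmult[OF inverse_power_radial(2)[OF that]])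
      show "2 * n * F' s + 4 * s * F'' s = - (\<beta> * k) * (n * (2 * n + 4) * s powr (- n - 1))"
        unfolding inverse_power_radial(3)[OF that, symmetric] F'_def F''_def by (simp add: algebra_simps)
    qed
    have dp: "\<sigma> * r \<le> norm (z - p)" if "z \<in> Q" for z
    proof -
      have z: "z \<in> cball \<xi> r" "0 \<le> height z" using that by (auto simp: Q_def)
      have "\<bar>g (fst z) - g (fst \<xi>)\<bar> \<le> L * norm (fst z - fst \<xi>)"
        using n19[OF z(1)] n19[of \<xi>] r norm_fst_le_norm[of z] norm_fst_le_norm[of \<xi>] by (intro lip) auto
      moreover have "norm (fst z - fst \<xi>) \<le> norm (z - p)" using norm_fst_le_norm[of "z - p"] by (simp add: p_def)
      then have "L * norm (fst z - fst \<xi>) \<le> L * norm (z - p)" using L by simp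
      moreover have "\<bar>snd z - (snd \<xi> - r/4)\<bar> \<le> norm (z - p)" using norm_snd_le_norm[of "z - p"] by (simp add: p_def)
      moreover have "snd z \<ge> g (fst z)" using z(2) by (simp add: height_def)
      ultimately have "r/4 \<le> norm (z - p) + L * norm (z - p)" using \<xi> by linarith
      then show ?thesis using L by (simp add: \<sigma>_def field_simps)
    qed
    have F\<alpha>: "F s \<ge> \<alpha>" if "s \<ge> (\<sigma> * r)\<^sup>2" for s
    proof -
      have "s powr (- n) \<le> ((\<sigma> * r)\<^sup>2) powr (- n)" using that \<sigma> r n by (intro powr_mono2') auto
      then have "k * s powr (- n) \<le> k * ((\<sigma> * r)\<^sup>2) powr (- n)" using k by simp
      also have "\<dots> = 1" using \<sigma> r by (simp add: k_def powr_minus)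
      finally have "\<beta> * (k * s powr (- n)) \<le> \<beta> * 1" using \<beta> by (intro mult_left_mono) auto
      then show ?thesis by (simp add: F_def mult.assoc)
    qed
    have nq: "norm (\<xi> - p) = r/4" using r by (simp add: p_def norm_Pair)
    have s0: "(norm (z - p))\<^sup>2 \<ge> (\<sigma> * r)\<^sup>2" "(norm (z - p))\<^sup>2 > 0" if "z \<in> Q" for z
    proof -
      show "(norm (z - p))\<^sup>2 \<ge> (\<sigma> * r)\<^sup>2" using dp[OF that] \<sigma> r by (intro power_mono) auto
      moreover have "(\<sigma> * r)\<^sup>2 > 0" using \<sigma> r by simp
      ultimately show "(norm (z - p))\<^sup>2 > 0" by linarith
    qed
    have yQ: "y \<in> Q" using y gy r by (auto simp: Q_def height_def)
    have "1 * u y \<le> 1 * F ((norm (y - p))\<^sup>2)"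
    proof (rule radial_comparison[where Q = Q and S = \<Omega> and F' = F' and F'' = F''])
      show "compact Q" unfolding Q_def by (rule compact_upper_cball) (rule n19)
      show "continuous_on Q u" by (rule continuous_u) (auto simp: Q_def n19)
      show "continuous_on Q (\<lambda>y. F ((norm (y - p))\<^sup>2))"
        unfolding F_def using s0 by (intro continuous_intros) fastforce+
      fix z s assume z: "z \<in> Q" and s: "s = (norm (z - p))\<^sup>2" and "1 * F s < 1 * u z"
      then have lt: "F s < u z" by simp
      have zr: "z \<in> cball \<xi> r" "0 \<le> height z" using z by (auto simp: Q_def)
      have sp: "s > 0" "s \<ge> (\<sigma> * r)\<^sup>2" using s0[OF z] s by auto
      \<comment> \<open>Being above \<open>\<alpha>\<close> serves twice: it keeps \<open>z\<close>
        off the graph, where \<open>u\<close> vanishes, and it bounds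
        \<open>u z powr (- \<gamma>)\<close> from above.\<close>
      have "u z > \<alpha>" using F\<alpha>[OF sp(2)] lt by simp
      then have hz: "height z > 0" using u_boundary[OF n19[OF zr(1)]] zr(2) \<alpha> by (cases "height z = 0") auto
      have "norm (z - \<xi>) \<noteq> r"
      proof
        assume e: "norm (z - \<xi>) = r"
        have "norm (z - p) \<ge> 3/4 * r"
          using norm_triangle_ineq2[of "z - p" "\<xi> - p"] norm_triangle_ineq4[of "z - p" "\<xi> - p"] e nq by simp
        then have "s \<ge> (3/4 * r)\<^sup>2" unfolding s using r by (intro power_mono) auto
        then have "s powr (- n) \<le> ((3/4 * r)\<^sup>2) powr (- n)" using r n by (intro powr_mono2') auto
        then have "k * s powr (- n) \<le> k * ((3/4 * r)\<^sup>2) powr (- n)" using k by simp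
        also have "\<dots> = ((4 * \<sigma> / 3)\<^sup>2) powr n"
        proof -
          have "((4 * \<sigma> / 3)\<^sup>2) powr n = ((\<sigma> * r)\<^sup>2 / (3/4 * r)\<^sup>2) powr n"
            using r by (simp add: power_divide power_mult_distrib mult.commute)
          also have "\<dots> = k / ((3/4 * r)\<^sup>2) powr n" unfolding k_def by (rule powr_divide)
          finally show ?thesis unfolding powr_minus_divide by (simp only: times_divide_eq_right mult_1_right)
        qed
        finally have "\<beta> * (k * s powr (- n)) \<le> \<beta> * (1 - D)" using \<beta> by (intro mult_left_mono) (auto simp: D_def)
        then have "\<beta> * D \<le> \<beta> - \<beta> * k * s powr (- n)" by (simp add: algebra_simps)
        then have "M' \<le> F s" using \<alpha> D by (simp add: F_def \<beta>_def)
        moreover have "u z \<le> M" using uM zr by (auto simp: height_def)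
        moreover have "r powr \<phi> \<ge> 0" by simp
        ultimately show False using lt unfolding M'_def by linarith
      qed
      then have "z \<in> ball \<xi> r" using zr by (auto simp: dist_norm norm_minus_commute)
      then have int: "z \<in> interior Q" unfolding Q_def using n19[OF zr(1)] hz by (intro interior_upper_cball)
      have z\<Omega>: "z \<in> \<Omega>" using \<Omega>I[OF n19[OF zr(1)] hz] .
      have "u z powr (- \<gamma>) \<le> \<alpha> powr (- \<gamma>)" using \<open>u z > \<alpha>\<close> \<alpha> \<gamma> by (intro powr_mono2') auto
      also have "\<dots> = a powr (- \<gamma>) * r powr (\<phi> - 2)"
        unfolding \<alpha>_def using a r by (intro powr_phi_neg_gamma \<gamma> \<phi>) auto
      also have "\<dots> < k0 * r powr (\<phi> - 2)"
      proof -
        have "a powr (- \<gamma>) \<le> a powr (- 1)" using a \<gamma> by (intro powr_mono) auto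
        also have "\<dots> = 1 / a" using a by (simp add: powr_minus divide_inverse)
        also have "\<dots> < k0" using k0 unfolding a_def by (simp add: field_simps)
        finally show ?thesis using r by simp
      qed
      also have "\<dots> = r powr \<phi> * k * (4 * r\<^sup>2) powr (- n - 1)"
      proof -
        have rr: "(r\<^sup>2) powr e = r powr (2 * e)" for e
          using r powr_powr[of r 2 e] by simp
        have "r powr \<phi> * k * (4 * r\<^sup>2) powr (- n - 1) = k0 * (r powr \<phi> * (r powr (2 * n) * r powr (2 * (- n - 1))))"
          unfolding k_def k0_def power_mult_distrib powr_mult rr by (simp only: mult_ac)
        also have "r powr \<phi> * (r powr (2 * n) * r powr (2 * (- n - 1))) = r powr (\<phi> - 2)"
          by (simp flip: powr_add)
        finally show ?thesis by simp
      qed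
      also have "\<dots> \<le> \<beta> * k * s powr (- n - 1)"
      proof -
        have "norm (z - p) \<le> norm (z - \<xi>) + norm (\<xi> - p)" using norm_triangle_ineq[of "z - \<xi>" "\<xi> - p"] by simp
        then have "norm (z - p) \<le> 2 * r" using nq zr r by (simp add: dist_norm norm_minus_commute)
        then have "s \<le> (2 * r)\<^sup>2" unfolding s by (intro power_mono) auto
        then have "(4 * r\<^sup>2) powr (- n - 1) \<le> s powr (- n - 1)"
          using sp n by (intro powr_mono2') (auto simp: power_mult_distrib)
        then show ?thesis using \<beta> k by (intro mult_mono) auto
      qed
      also have "\<dots> \<le> \<beta> * k * (n * (2 * n + 4) * s powr (- n - 1))"
      proof -
        have "1 * 1 \<le> n * (2 * n + 4)" using n by (intro mult_mono) auto
        then have "1 * s powr (- n - 1) \<le> n * (2 * n + 4) * s powr (- n - 1)" by (intro mult_right_mono) auto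
        then show ?thesis using \<beta> k by (intro mult_left_mono) auto
      qed
      finally have "2 * n * F' s + 4 * s * F'' s < laplacian u z"
        using dF(3)[OF sp(1)] \<Omega>_props z\<Omega> by force
      moreover have "\<forall>\<^sub>F s in nhds s. (F has_real_derivative F' s) (at s)"
        using sp(1) dF(1) by (auto simp: eventually_nhds intro!: exI[of _ "{0<..}"])
      ultimately show "z \<in> interior Q \<and> z \<in> \<Omega> \<and> (\<forall>\<^sub>F s in nhds s. (F has_real_derivative F' s) (at s)) \<and>
          (F' has_real_derivative F'' s) (at s) \<and>
          1 * (2 * real DIM((real ^ 'm) \<times> real) * F' s + 4 * s * F'' s) < 1 * laplacian u z"
        using int z\<Omega> dF(2)[OF sp(1)] unfolding n_def by simp
    qed (use \<Omega>_props yQ in auto)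
    then have uy: "u y \<le> F ((norm (y - p))\<^sup>2)" by simp
    have "norm (y - p) \<le> norm (y - \<xi>) + norm (\<xi> - p)" using norm_triangle_ineq[of "y - \<xi>" "\<xi> - p"] by simp
    then have "norm (y - p) \<le> r / 2" using nq y by (simp add: dist_norm norm_minus_commute)
    then have "(norm (y - p))\<^sup>2 \<le> (r/2)\<^sup>2" by (intro power_mono) auto
    then have "((r/2)\<^sup>2) powr (- n) \<le> ((norm (y - p))\<^sup>2) powr (- n)" using s0[OF yQ] n by (intro powr_mono2') auto
    then have "k * ((r/2)\<^sup>2) powr (- n) \<le> k * ((norm (y - p))\<^sup>2) powr (- n)" using k by simp
    moreover have "k * ((r/2)\<^sup>2) powr (- n) = ((2 * \<sigma>)\<^sup>2) powr n"
    proof -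
      have "((2 * \<sigma>)\<^sup>2) powr n = ((\<sigma> * r)\<^sup>2 / (r/2)\<^sup>2) powr n"
        using r by (simp add: power_divide power_mult_distrib mult.commute)
      also have "\<dots> = k / ((r/2)\<^sup>2) powr n" unfolding k_def by (rule powr_divide)
      finally show ?thesis unfolding powr_minus_divide by (simp only: times_divide_eq_right mult_1_right)
    qed
    ultimately have "\<beta> * ((2 * \<sigma>)\<^sup>2) powr n \<le> \<beta> * (k * ((norm (y - p))\<^sup>2) powr (- n))"
      using \<beta> by (intro mult_left_mono) auto
    then have "F ((norm (y - p))\<^sup>2) \<le> \<alpha> + \<beta> * (1 - ((2 * \<sigma>)\<^sup>2) powr n)"
      by (simp add: F_def algebra_simps)
    also have "\<dots> = \<alpha> + \<theta> * M'" by (simp add: \<beta>_def \<theta>_def)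
    also have "\<dots> \<le> \<theta> * M + (a + 1) * r powr \<phi>"
      using \<theta>1 mult_right_mono[of \<theta> 1 "r powr \<phi>"] by (simp add: \<alpha>_def M'_def algebra_simps)
    finally show "u y \<le> \<theta> * M + (a + 1) * r powr \<phi>" using uy by simp
  qed (use \<theta>0 \<theta>1 a in auto)
qed

section \<open>Carleson estimate\<close>

text \<open>Supplies the distance hypothesis of the propagation lemmas with
  \<open>\<epsilon> = 1\<close>, that is, on the ball of half the radius.\<close>

lemma double_square_le:
  fixes a R :: real
  assumes "0 \<le> a" "a \<le> R / 2"
  shows "(1 + 1) * a\<^sup>2 \<le> R\<^sup>2"
proof -
  have "4 * a\<^sup>2 \<le> R\<^sup>2" using power_mono[OF assms(2,1), of 2] by (simp add: power_divide)
  moreover have "0 \<le> a\<^sup>2" by simp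
  ultimately show ?thesis unfolding one_add_one by linarith
qed

section \<open>Transporting lower bounds to \<open>e_n\<close>\<close>

context flat_solution
begin

lemma height_pos_ball:
  assumes "norm x + R \<le> 19" "(1 + L) * R \<le> height x" "0 \<le> R"
  shows "y \<in> cball x R \<Longrightarrow> 0 \<le> height y" and "y \<in> ball x R \<Longrightarrow> 0 < height y"
proof -
  have *: "height x - (1 + L) * norm (x - y) \<le> height y" if "y \<in> cball x R" for y
  proof -
    have "norm y \<le> 19" using that assms norm_triangle_ineq2[of y x] by (simp add: dist_norm norm_minus_commute)
    then show ?thesis using height_lipschitz[of x y] assms by auto
  qed
  show "0 \<le> height y" if "y \<in> cball x R"
  proof -
    have "(1 + L) * norm (x - y) \<le> (1 + L) * R" using that L by (simp add: dist_norm)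
    then show ?thesis using *[OF that] assms by linarith
  qed
  show "0 < height y" if "y \<in> ball x R"
  proof -
    have "(1 + L) * norm (x - y) < (1 + L) * R" using that L by (simp add: dist_norm)
    moreover have "y \<in> cball x R" using that by auto
    ultimately show ?thesis using *[of y] assms by linarith
  qed
qed

lemma propagate:
  assumes R: "norm x + R \<le> 19" and nn: "\<And>y. y \<in> cball x R \<Longrightarrow> 0 \<le> height y"
    and pos: "\<And>y. y \<in> ball x R \<Longrightarrow> 0 < height y"
    and "0 < \<rho>" "\<rho> < R" "m > 0" "\<And>y. y \<in> cball x \<rho> \<Longrightarrow> m \<le> u y"
    and "0 \<le> \<epsilon>" "\<epsilon> \<le> 1" "(1 + \<epsilon>) * (norm (y - x))\<^sup>2 \<le> R\<^sup>2"
  shows "m * \<epsilon> * (\<rho> / R) ^ (2 * DIM((real ^ 'm) \<times> real)) \<le> u y"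
proof -
  have n: "norm y \<le> 19" if "y \<in> cball x R" for y
    using that R norm_triangle_ineq2[of y x] by (simp add: dist_norm norm_minus_commute)
  show ?thesis
  proof (rule superharmonic_propagation[where S = \<Omega> and x = x])
    show "continuous_on (cball x R) u" using n nn by (intro continuous_u) auto
    show "0 \<le> u y" if "y \<in> cball x R" for y using u_nonneg n nn that by auto
    show "ball x R \<subseteq> \<Omega>"
    proof
      fix y assume y: "y \<in> ball x R"
      then have "y \<in> cball x R" by auto
      then show "y \<in> \<Omega>" using n[of y] pos[OF y] \<Omega>I by auto
    qed
  qed (use assms \<Omega>_props lane_emden_laplacian_neg[OF lane_emden] in auto)
qed

text \<open>The last link of the chain: from a point this high, one ball staying above the level
  1/10, hence above the graph, contains \<open>e_n\<close> well inside.\<close>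

lemma e_n_reached:
  assumes x: "norm (fst x) \<le> 2" "5 \<le> height x" "height x \<le> 7" and \<rho>: "0 < \<rho>" "\<rho> \<le> 7/2"
    and m: "m > 0" "\<And>y. y \<in> cball x \<rho> \<Longrightarrow> m \<le> u y"
  shows "m * (3/49) * (\<rho> / 7) ^ (2 * DIM((real ^ 'm) \<times> real)) \<le> u e_n"
proof -
  have gx: "\<bar>g (fst x)\<bar> \<le> 1/10" using x flat' by simp
  define t where "t = snd x"
  have t: "49/10 \<le> t" "t \<le> 71/10" using gx x by (auto simp: height_def t_def)
  \<comment> \<open>The ball is tangent to the level 1/10. As t is at least 4.9, \<open>e_n\<close>
    satisfies a bound by \<open>R\<^sup>2 - 3\<close>, and since \<open>R \<le> 7\<close> this
    permits \<open>\<epsilon> = 3/49\<close>.\<close>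
  define R where "R = t - 1/10"
  have R: "48/10 \<le> R" "R \<le> 7" using t by (auto simp: R_def)
  have nx: "norm x \<le> 2 + 71/10" using norm_Pair_le[of "fst x" "snd x"] x t by (simp add: t_def)
  have nR: "norm x + R \<le> 19" using nx R by simp
  have gy: "\<bar>g (fst y)\<bar> \<le> 1/10" if "y \<in> cball x R" for y
  proof -
    have "norm y \<le> 19" using that nR norm_triangle_ineq2[of y x] by (simp add: dist_norm norm_minus_commute)
    then show ?thesis using flat'[of "fst y"] norm_fst_le_norm[of y] by simp
  qed
  have sy: "t - norm (x - y) \<le> snd y" for y :: "(real ^ 'm) \<times> real"
    using norm_snd_le_norm[of "x - y"] by (simp add: t_def)
  have "(norm (e_n - x))\<^sup>2 = (norm (fst x))\<^sup>2 + (1 - t)\<^sup>2"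
    unfolding e_n_def t_def by (cases x) (simp add: norm_Pair)
  moreover have "(norm (fst x))\<^sup>2 \<le> 2\<^sup>2" using x by (intro power_mono) auto
  ultimately have d: "(norm (e_n - x))\<^sup>2 \<le> R\<^sup>2 - 3"
    using t by (simp add: R_def power2_eq_square algebra_simps)
  have "R\<^sup>2 \<le> 7\<^sup>2" using R by (intro power_mono) auto
  then have "(1 + 3/49) * (norm (e_n - x))\<^sup>2 \<le> R\<^sup>2" using d by simp
  then have "m * (3/49) * (\<rho> / R) ^ (2 * DIM((real ^ 'm) \<times> real)) \<le> u e_n"
  proof (intro propagate[OF nR])
    show "0 \<le> height y" if "y \<in> cball x R" for y
      using gy[OF that] sy[of y] that by (auto simp: height_def R_def dist_norm)
    show "0 < height y" if "y \<in> ball x R" for y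
      using gy[of y] sy[of y] that by (auto simp: height_def R_def dist_norm)
  qed (use \<rho> R m in auto)
  moreover have "(\<rho> / 7) ^ (2 * DIM((real ^ 'm) \<times> real)) \<le> (\<rho> / R) ^ (2 * DIM((real ^ 'm) \<times> real))"
    using \<rho> R by (intro power_mono frac_le) auto
  then have "m * (3/49) * (\<rho> / 7) ^ (2 * DIM((real ^ 'm) \<times> real)) \<le> m * (3/49) * (\<rho> / R) ^ (2 * DIM((real ^ 'm) \<times> real))"
    using m by (intro mult_left_mono) auto
  ultimately show ?thesis by linarith
qed

lemma axis_cball_subset:
  assumes t: "0 < t" "t \<le> 1"
  shows "cball (t *\<^sub>R e_n) (t / 2) \<subseteq> \<Omega>"
proof
  fix y :: "(real ^ 'm) \<times> real" assume "y \<in> cball (t *\<^sub>R e_n) (t / 2)"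
  then have d: "norm (y - t *\<^sub>R e_n) \<le> t / 2" by (simp add: dist_norm norm_minus_commute)
  have f: "norm (fst y) \<le> t / 2" "\<bar>snd y - t\<bar> \<le> t / 2"
    using norm_fst_le_norm[of "y - t *\<^sub>R e_n"] norm_snd_le_norm[of "y - t *\<^sub>R e_n"] d by (auto simp: e_n_def)
  have "norm y \<le> norm (fst y) + \<bar>snd y\<bar>" using norm_Pair_le[of "fst y" "snd y"] by simp
  then have "norm y \<le> 19" using f t by linarith
  moreover have "(norm (fst y))\<^sup>2 \<le> norm (fst y) * 1" unfolding power2_eq_square
    using f t by (intro mult_left_mono) auto
  then have "\<bar>g (fst y)\<bar> \<le> t / 8000" using flat[of "fst y"] f t by auto
  then have "0 < height y" using f t unfolding height_def by linarith
  ultimately show "y \<in> \<Omega>" by (rule \<Omega>I)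
qed

lemma axis_lower_bound:
  assumes t: "0 < t" "t \<le> 1" and \<phi>: "\<phi> = 2 / (1 + \<gamma>)"
  shows "(t / 2) powr \<phi> / (4 * DIM((real ^ 'm) \<times> real)) \<le> u (t *\<^sub>R e_n)"
  using t by (intro interior_lower_bound[OF \<gamma> \<phi> lane_emden] axis_cball_subset) auto

end

text \<open>Climbing multiplies the height by the fixed factor \<open>b\<close> and the lower bound
  by a fixed factor per step. The number of steps is logarithmic in the initial height, so the total
  loss is a power of that height. The invariant is a lower bound on the ball whose radius is half of
  \<open>\<kappa>\<close> times the height.\<close>

lemma vertical_chain:
  fixes \<gamma> L :: real
  assumes \<gamma>: "\<gamma> > 1" and L: "L > 0"
  shows "\<exists>N c. 0 < c \<and> (\<forall>(g :: real ^ 'm \<Rightarrow> real) u x m. flat_solution \<gamma> L g u \<longrightarrow>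
    norm (fst x) \<le> 2 \<longrightarrow> 0 < snd x - g (fst x) \<longrightarrow> snd x - g (fst x) \<le> 7 \<longrightarrow> 0 < m \<longrightarrow>
    (\<forall>y\<in>cball x ((snd x - g (fst x)) / (2 * (1 + L))). m \<le> u y) \<longrightarrow>
    c * (snd x - g (fst x)) ^ N * m \<le> u e_n)"
proof -
  define n2 where "n2 = 2 * DIM((real ^ 'm) \<times> real)"
  define \<kappa> where "\<kappa> = 1 / (1 + L)"
  have \<kappa>: "0 < \<kappa>" "\<kappa> \<le> 1" using L by (auto simp: \<kappa>_def)
  define b where "b = 1 + \<kappa> / 4"
  have b: "1 < b" "b \<le> 5/4" using \<kappa> by (auto simp: b_def)
  \<comment> \<open>One step costs the factor 5^(-n2) and multiplies the height by \<open>b\<close>;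
    with this \<open>N\<close>, the product \<open>height ^ N * m\<close> does not decrease along
    the chain. The 7^N in \<open>c\<close> normalises the final height, which is at most 7.\<close>
  obtain N where N: "5 ^ n2 < b ^ N" using real_arch_pow[OF b(1)] by blast
  define c where "c = 3/49 * (\<kappa> / 7) ^ n2 / 7 ^ N"
  have c: "c > 0" using \<kappa> by (simp add: c_def)
  have "c * (snd x - g (fst x)) ^ N * m \<le> u e_n"
    if fs: "flat_solution \<gamma> L g u" and x: "norm (fst x) \<le> 2" "0 < snd x - g (fst x)" "snd x - g (fst x) \<le> 7"
      and m: "0 < m" "\<forall>y\<in>cball x ((snd x - g (fst x)) / (2 * (1 + L))). m \<le> u y"
    for g :: "real ^ 'm \<Rightarrow> real" and u x m
  proof -
    interpret flat_solution \<gamma> L g u by (rule fs)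
    have base: "c * (height x) ^ N * m \<le> u e_n"
      if x: "norm (fst x) \<le> 2" "5 \<le> height x" "height x \<le> 7" and m: "0 < m"
        "\<forall>y\<in>cball x (\<kappa> * height x / 2). m \<le> u y" for x m
    proof -
      have h: "\<kappa> \<le> \<kappa> * height x / 2" "\<kappa> * height x / 2 \<le> 7/2"
        using \<kappa> x mult_mono[of \<kappa> 1 "height x" 7] by auto
      have "m * (3/49) * (\<kappa> * height x / 2 / 7) ^ n2 \<le> u e_n"
        unfolding n2_def using x m h \<kappa> by (intro e_n_reached) auto
      moreover have "m * (3/49) * (\<kappa> / 7) ^ n2 \<le> m * (3/49) * (\<kappa> * height x / 2 / 7) ^ n2"
        using m h \<kappa> by (intro mult_left_mono power_mono divide_right_mono) auto
      moreover have "c * (height x) ^ N * m \<le> c * 7 ^ N * m"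
        using c m x by (intro mult_right_mono mult_left_mono power_mono) auto
      moreover have "c * 7 ^ N * m = m * (3/49) * (\<kappa> / 7) ^ n2" by (simp add: c_def)
      ultimately show ?thesis by linarith
    qed
    have chain: "c * (height x) ^ N * m \<le> u e_n"
      if "norm (fst x) \<le> 2" "0 < height x" "height x \<le> 7" "5 \<le> b ^ k * height x" "0 < m"
        "\<forall>y\<in>cball x (\<kappa> * height x / 2). m \<le> u y" for k x m
      using that
    proof (induction k arbitrary: x m)
      case 0
      then show ?case using base by simp
    next
      case (Suc k)
      show ?case
      proof (cases "height x \<ge> 5")
        case True
        then show ?thesis using base Suc.prems by simp
      next
        case False
        define h where "h = height x"
        have h: "0 < h" "h < 5" using False Suc.prems by (auto simp: h_def)
        \<comment> \<open>The rise is such that the ball of radius \<open>\<kappa> * h / 4\<close>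
          about \<open>z\<close> lies in the ball where \<open>m\<close> is already a lower bound.
          The ball of radius \<open>R\<close> about \<open>z\<close> stays above the graph, and the
          ratio of the radii is \<open>1 / (4 * b)\<close>, at least 1/5.\<close>
        define z where "z = x + (0, \<kappa> / 4 * h)"
        have hz: "height z = b * h" by (simp add: z_def height_def h_def b_def algebra_simps)
        have fz: "fst z = fst x" by (simp add: z_def)
        have bh: "b * h \<le> 25/4" using mult_mono[of b "5/4" h 5] b h by simp
        define R where "R = \<kappa> * (b * h)"
        have R: "0 < R" "R \<le> 25/4" using \<kappa> b h bh mult_mono[of \<kappa> 1 "b * h" "25/4"] by (auto simp: R_def)
        have LR: "(1 + L) * R = height z" using L by (simp add: R_def \<kappa>_def hz)
        have "norm z \<le> norm (fst z) + norm (snd z)" using norm_Pair_le[of "fst z" "snd z"] by simp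
        moreover have "\<bar>snd z\<bar> \<le> 25/4 + 1/10"
        proof -
          have "0 < b * h" using b h by simp
          then show ?thesis using hz bh flat'[of "fst z"] fz Suc.prems(1) unfolding height_def by auto
        qed
        ultimately have nR: "norm z + R \<le> 19" using R Suc.prems(1) fz by simp
        have xz: "norm (z - x) = \<kappa> / 4 * h" using \<kappa> h by (simp add: z_def norm_Pair)
        have mz: "m \<le> u y" if "y \<in> cball z (\<kappa> * h / 4)" for y
        proof -
          have "norm (y - x) \<le> norm (y - z) + norm (z - x)" using norm_triangle_ineq[of "y - z" "z - x"] by simp
          then have "y \<in> cball x (\<kappa> * height x / 2)"
            using that xz by (simp add: dist_norm norm_minus_commute h_def)
          then show ?thesis using Suc.prems by blast
        qed
        define m' where "m' = m * (1/5) ^ n2"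
        have m': "m' > 0" using Suc.prems by (simp add: m'_def)
        have "m' \<le> u y" if y: "y \<in> cball z (\<kappa> * height z / 2)" for y
        proof -
          have "norm (y - z) \<le> R / 2" using y by (simp add: R_def hz dist_norm norm_minus_commute)
          then have "(1 + 1) * (norm (y - z))\<^sup>2 \<le> R\<^sup>2" by (intro double_square_le) auto
          moreover have "\<kappa> * h / 4 < R" using \<kappa> h b mult_strict_left_mono[of "h/4" "b * h" \<kappa>] by (simp add: R_def)
          ultimately have "m * 1 * (\<kappa> * h / 4 / R) ^ n2 \<le> u y" unfolding n2_def
            using height_pos_ball[OF nR] LR R mz Suc.prems(5) \<kappa> h by (intro propagate[OF nR]) auto
          moreover have "\<kappa> * h / 4 / R = 1 / (4 * b)" using \<kappa> h b by (simp add: R_def)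
          moreover have "(1/5) ^ n2 \<le> (1 / (4 * b)) ^ n2" using b by (intro power_mono) (auto simp: field_simps)
          then have "m * (1/5) ^ n2 \<le> m * (1 / (4 * b)) ^ n2" using Suc.prems(5) by simp
          ultimately show ?thesis by (simp add: m'_def)
        qed
        moreover have "5 \<le> b ^ k * height z" using Suc.prems(4) by (simp add: hz h_def mult.assoc mult.left_commute)
        ultimately have "c * (height z) ^ N * m' \<le> u e_n"
          using Suc.prems(1) fz hz bh h b m' by (intro Suc.IH) auto
        moreover have "c * h ^ N * m \<le> c * (height z) ^ N * m'"
        proof -
          have "1 \<le> b ^ N * (1/5) ^ n2" using N by (simp add: power_one_over field_simps)
          then have "(c * h ^ N * m) * 1 \<le> (c * h ^ N * m) * (b ^ N * (1/5) ^ n2)"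
            using c h Suc.prems(5) by (intro mult_left_mono) auto
          then show ?thesis by (simp add: hz m'_def power_mult_distrib algebra_simps)
        qed
        ultimately show ?thesis by (simp add: h_def)
      qed
    qed
    have hx: "snd x - g (fst x) = height x" by (simp add: height_def)
    obtain k where "5 / height x < b ^ k" using real_arch_pow[OF b(1)] by blast
    then have "5 \<le> b ^ k * height x" using x unfolding hx by (simp add: field_simps)
    then show ?thesis unfolding hx using x m unfolding hx
      by (intro chain) (auto simp: \<kappa>_def field_simps)
  qed
  then show ?thesis using c by (intro exI[of _ N] exI[of _ c]) blast
qed

text \<open>Repeating the decay on balls shrinking by the factor 4 makes the coefficient of
  \<open>M\<close> as small as desired, while each round adds at most
  \<open>A * r powr \<phi>\<close>.\<close>

lemma boundary_decay_iterated:
  fixes \<gamma> L \<phi> q :: real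
  assumes \<gamma>: "\<gamma> > 1" and L: "L > 0" and \<phi>: "\<phi> = 2 / (1 + \<gamma>)" and q: "q > 0"
  shows "\<exists>k A. 0 < A \<and>
    (\<forall>(g :: real ^ 'm \<Rightarrow> real) u \<xi> r M. flat_solution \<gamma> L g u \<longrightarrow> 0 < r \<longrightarrow> 0 \<le> M \<longrightarrow>
      norm \<xi> + r \<le> 19 \<longrightarrow> snd \<xi> = g (fst \<xi>) \<longrightarrow>
      (\<forall>y\<in>cball \<xi> r. g (fst y) \<le> snd y \<longrightarrow> u y \<le> M) \<longrightarrow>
      (\<forall>y\<in>cball \<xi> (r / 4 ^ k). g (fst y) \<le> snd y \<longrightarrow> u y \<le> q * M + A * r powr \<phi>))"
proof -
  obtain \<theta> A where \<theta>: "0 \<le> \<theta>" "\<theta> < 1" and A: "0 < A" and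
    dec: "\<And>(g :: real ^ 'm \<Rightarrow> real) u \<xi> r M y. \<lbrakk>flat_solution \<gamma> L g u; 0 < r; 0 \<le> M;
      norm \<xi> + r \<le> 19; snd \<xi> = g (fst \<xi>); \<And>y. y\<in>cball \<xi> r \<Longrightarrow> g (fst y) \<le> snd y \<Longrightarrow> u y \<le> M;
      y\<in>cball \<xi> (r/4); g (fst y) \<le> snd y\<rbrakk> \<Longrightarrow> u y \<le> \<theta> * M + A * r powr \<phi>"
    using boundary_decay[OF \<gamma> L \<phi>, where 'm = 'm] by metis
  obtain k where k: "\<theta> ^ k < q" using real_arch_pow_inv[OF q \<theta>(2)] by blast
  show ?thesis
  \<comment> \<open>The rounds contribute \<open>k * A\<close>; one more \<open>A\<close> keeps the
    constant positive if \<open>k = 0\<close>.\<close>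
  proof (intro exI[of _ k] exI[of _ "(real k + 1) * A"] conjI allI impI ballI)
    fix g :: "real ^ 'm \<Rightarrow> real" and u \<xi> r M y
    assume fs: "flat_solution \<gamma> L g u" and r: "0 < r" and M: "0 \<le> M" and n\<xi>: "norm \<xi> + r \<le> 19"
      and \<xi>: "snd \<xi> = g (fst \<xi>)" and uM: "\<forall>y\<in>cball \<xi> r. g (fst y) \<le> snd y \<longrightarrow> u y \<le> M"
      and y: "y \<in> cball \<xi> (r/4^k)" and gy: "g (fst y) \<le> snd y"
    have "u y \<le> \<theta> ^ j * M + j * A * r powr \<phi>" if "y \<in> cball \<xi> (r/4^j)" "g (fst y) \<le> snd y" for j y
      using that
    proof (induction j arbitrary: y)
      case 0
      then show ?case using uM by simp
    next
      case (Suc j)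
      define M1 where "M1 = \<theta> ^ j * M + j * A * r powr \<phi>"
      have M1: "0 \<le> M1" using \<theta> M A by (simp add: M1_def)
      have rj: "r / 4 ^ j \<le> r" using r by (simp add: field_simps)
      have "u y \<le> \<theta> * M1 + A * (r / 4 ^ j) powr \<phi>"
      proof (rule dec[OF fs _ M1 _ \<xi>])
        show "y \<in> cball \<xi> (r / 4 ^ j / 4)" using Suc.prems by (simp add: mult.commute)
      qed (use Suc r rj n\<xi> in \<open>auto simp: M1_def\<close>)
      also have "\<dots> \<le> \<theta> * M1 + A * r powr \<phi>"
        using rj r A phi_exponents[OF \<gamma> \<phi>] by (intro add_left_mono mult_left_mono powr_mono2) auto
      also have "\<dots> \<le> \<theta> ^ Suc j * M + Suc j * A * r powr \<phi>"
        using mult_right_mono[of \<theta> 1 "j * A * r powr \<phi>"] \<theta> A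
        by (simp add: M1_def algebra_simps)
      finally show ?case .
    qed
    from this[OF y gy] have "u y \<le> \<theta> ^ k * M + k * A * r powr \<phi>" .
    also have "\<dots> \<le> q * M + (real k + 1) * A * r powr \<phi>"
      using k M A by (intro add_mono mult_right_mono) auto
    finally show "u y \<le> q * M + (real k + 1) * A * r powr \<phi>" .
  qed (use A in simp)
qed

lemma carleson_estimate:
  fixes \<gamma> L :: real
  assumes \<gamma>: "\<gamma> > 1" and L: "L > 0"
  shows "\<exists>C>0. \<forall>(g :: real ^ 'm \<Rightarrow> real) u y. flat_solution \<gamma> L g u \<longrightarrow>
    norm y \<le> 3/2 \<longrightarrow> g (fst y) \<le> snd y \<longrightarrow> u y \<le> C * u e_n"
proof -
  define \<phi> where "\<phi> = 2 / (1 + \<gamma>)"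
  note ph = phi_exponents[OF \<gamma> \<phi>_def]
  define n2 where "n2 = 2 * DIM((real ^ 'm) \<times> real)"
  obtain N1 c where c: "0 < c" and
    chain: "\<And>(g :: real ^ 'm \<Rightarrow> real) u x m. \<lbrakk>flat_solution \<gamma> L g u;
      norm (fst x) \<le> 2; 0 < snd x - g (fst x); snd x - g (fst x) \<le> 7; 0 < m;
      \<forall>y\<in>cball x ((snd x - g (fst x)) / (2 * (1 + L))). m \<le> u y\<rbrakk> \<Longrightarrow>
      c * (snd x - g (fst x)) ^ N1 * m \<le> u e_n"
    using vertical_chain[OF \<gamma> L, where 'm = 'm] by metis
  \<comment> \<open>The climb to \<open>e_n\<close> loses the power \<open>N1\<close> of h, and
    enlarging the ball where \<open>u\<close> is known to be large loses the power
    \<open>n2\<close>; the weight has to compensate both.\<close>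
  define N where "N = N1 + n2"
  have N0: "N > 0" by (simp add: N_def n2_def)
  \<comment> \<open>Around the maximum point \<open>u\<close> is at most \<open>2 ^ N * u x\<close>,
    so this decay factor leaves \<open>u x / 2\<close>, which can be absorbed on the left.\<close>
  have q: "1 / (2 * 2 ^ N) > (0::real)" and B: "(2::real) ^ N \<ge> 1" by simp_all
  obtain k A where A: "0 < A" and
    dec: "\<And>(g :: real ^ 'm \<Rightarrow> real) u \<xi> r M y. \<lbrakk>flat_solution \<gamma> L g u; 0 < r; 0 \<le> M;
      norm \<xi> + r \<le> 19; snd \<xi> = g (fst \<xi>); \<And>y. y\<in>cball \<xi> r \<Longrightarrow> g (fst y) \<le> snd y \<Longrightarrow> u y \<le> M;
      y\<in>cball \<xi> (r / 4 ^ k); g (fst y) \<le> snd y\<rbrakk> \<Longrightarrow> u y \<le> (1 / (2 * 2 ^ N)) * M + A * r powr \<phi>"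
    using boundary_decay_iterated[OF \<gamma> L \<phi>_def q, where 'm = 'm] by metis
  obtain \<delta> where \<delta>: "0 < \<delta>" "\<delta> \<le> 1/4" and
    half: "\<And>S (u :: (real ^ 'm) \<times> real \<Rightarrow> real) x \<rho> y. \<lbrakk>lane_emden_on \<gamma> S u; cball x \<rho> \<subseteq> S; 0 < \<rho>;
      \<forall>y\<in>cball x \<rho>. u y \<le> 2 ^ N * u x; y \<in> cball x (\<delta> * \<rho>)\<rbrakk> \<Longrightarrow> u x / 2 \<le> u y"
    using interior_half_bound[OF \<gamma> B, where 'a = "(real ^ 'm) \<times> real"] by metis
  define \<kappa> where "\<kappa> = 1 / (1 + L)"
  have \<kappa>: "0 < \<kappa>" "\<kappa> \<le> 1" using L by (auto simp: \<kappa>_def)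
  \<comment> \<open>Points of height at most \<open>\<epsilon> * h\<close> lie in the ball that
    remains when the radius \<open>h / 4\<close> is shrunk k times by the factor 4.\<close>
  define \<epsilon> where "\<epsilon> = (1 / 4 ^ k) / (4::real)"
  have \<epsilon>: "0 < \<epsilon>" "\<epsilon> \<le> 1/4" by (auto simp: \<epsilon>_def)
  define c1 where "c1 = (1 / 2) powr \<phi> / (4 * DIM((real ^ 'm) \<times> real))"
  have c1: "c1 > 0" by (simp add: c1_def)
  define c2 where "c2 = c * \<epsilon> ^ N1 * ((\<delta> * \<epsilon> / 3) ^ n2 / 2)"
  have c2: "c2 > 0" using c \<epsilon> \<delta> by (simp add: c2_def)
  define C where "C = 2 * A * 2 ^ N / c1 + 1 / c2"
  have C: "C > 0" using A c1 c2 by (simp add: C_def add_pos_pos)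
  have "u y \<le> 2 ^ N * C * u e_n"
    if fs: "flat_solution \<gamma> L g u" and y: "norm y \<le> 3/2" "g (fst y) \<le> snd y"
    for g :: "real ^ 'm \<Rightarrow> real" and u y
  proof -
    interpret flat_solution \<gamma> L g u by (rule fs)
    have en: "norm (e_n :: (real ^ 'm) \<times> real) = 1" by (simp add: e_n_def norm_Pair)
    have hen: "height e_n > 0" using flat'[of 0] by (simp add: height_def e_n_def)
    have lam: "c1 \<le> u e_n" using axis_lower_bound[of 1 \<phi>] \<phi>_def by (simp add: c1_def)
    define Q where "Q = cball 0 2 \<inter> {y. 0 \<le> height y}"
    have Qn: "norm z \<le> 19" "0 \<le> height z" "norm z \<le> 2" if "z \<in> Q" for z using that by (auto simp: Q_def)
    define w where "w y = u y * (2 - norm y) ^ N" for y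
    have "compact Q" unfolding Q_def by (rule compact_upper_cball) auto
    moreover have "continuous_on Q w" unfolding w_def
      using Qn by (intro continuous_intros continuous_u) auto
    moreover have enQ: "e_n \<in> Q" using en hen by (simp add: Q_def)
    ultimately obtain x where x: "x \<in> Q" and max: "\<And>z. z \<in> Q \<Longrightarrow> w z \<le> w x"
      using continuous_attains_sup[of Q w] by blast
    have "w e_n > 0" using lam c1 en by (simp add: w_def)
    then have wx: "w x > 0" using max[OF enQ] by simp
    define h where "h = 2 - norm x"
    have h: "0 < h" "h \<le> 2"
    proof -
      have "h \<noteq> 0" using wx N0 by (auto simp: w_def h_def zero_power)
      then show "0 < h" "h \<le> 2" using Qn[OF x] by (auto simp: h_def)
    qed
    have ux: "u x > 0" using wx h by (simp add: w_def h_def zero_less_mult_iff)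
    define d where "d = height x"
    have d0: "d > 0" using ux u_boundary[of x] Qn[OF x] by (cases "d = 0") (auto simp: d_def)
    have fx: "norm (fst x) \<le> 2" "\<bar>snd x\<bar> \<le> 2"
      using norm_fst_le_norm[of x] norm_snd_le_norm[of x] Qn[OF x] by auto
    have d3: "d \<le> 3" using fx flat'[of "fst x"] by (auto simp: d_def height_def)
    \<comment> \<open>Within \<open>h / 2\<close> of \<open>x\<close> the weight drops at most by
      the factor \<open>2 ^ N\<close>, so maximality of \<open>w x\<close> bounds
      \<open>u\<close>.\<close>
    have near: "u z \<le> 2 ^ N * u x" if "norm (z - x) \<le> h / 2" "0 \<le> height z" for z
    proof -
      have hz: "2 - norm z \<ge> h / 2" using norm_triangle_ineq2[of z x] that by (simp add: h_def)
      then have zQ: "z \<in> Q" using that h by (simp add: Q_def)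
      have "u z * (h / 2) ^ N \<le> u z * (2 - norm z) ^ N"
        using hz h u_nonneg[of z] Qn[OF zQ] by (intro mult_left_mono power_mono) auto
      also have "\<dots> \<le> u x * h ^ N" using max[OF zQ] by (simp add: w_def h_def)
      finally show ?thesis using h by (simp add: power_divide field_simps)
    qed
    have "w x \<le> C * u e_n"
    proof (cases "d \<le> \<epsilon> * h")
      case True
      define \<xi> where "\<xi> = (fst x, g (fst x))"
      have x\<xi>: "norm (x - \<xi>) = d" using d0 by (cases x) (simp add: \<xi>_def norm_Pair d_def height_def)
      have dh: "d \<le> h / 4" using True mult_right_mono[OF \<epsilon>(2), of h] h by linarith
      have "u x \<le> (1 / (2 * 2 ^ N)) * (2 ^ N * u x) + A * (h / 4) powr \<phi>"
      proof (rule dec[OF fs, where \<xi> = \<xi>])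
        have "norm \<xi> \<le> norm x + d" using norm_triangle_ineq3[of \<xi> x] x\<xi> by (simp add: norm_minus_commute)
        then show "norm \<xi> + h / 4 \<le> 19" using dh h Qn[OF x] by simp
        show "x \<in> cball \<xi> (h / 4 / 4 ^ k)" using True x\<xi> by (simp add: dist_norm norm_minus_commute \<epsilon>_def)
        show "g (fst x) \<le> snd x" using d0 by (simp add: d_def height_def)
        fix z assume z: "z \<in> cball \<xi> (h / 4)" "g (fst z) \<le> snd z"
        have "norm (z - x) \<le> norm (z - \<xi>) + norm (\<xi> - x)" using norm_triangle_ineq[of "z - \<xi>" "\<xi> - x"] by simp
        then have "norm (z - x) \<le> h / 2" using z x\<xi> dh by (simp add: dist_norm norm_minus_commute)
        then show "u z \<le> 2 ^ N * u x" using z by (intro near) (auto simp: height_def)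
      qed (use h ux in \<open>auto simp: \<xi>_def\<close>)
      moreover have "(1 / (2 * 2 ^ N)) * (2 ^ N * u x) = u x / 2" by simp
      moreover have "(h / 4) powr \<phi> \<le> 1 powr \<phi>" using h ph by (intro powr_mono2) auto
      then have "A * (h / 4) powr \<phi> \<le> A * 1" using A by (intro mult_left_mono) auto
      ultimately have "u x \<le> 2 * A" by linarith
      then have "w x \<le> 2 * A * 2 ^ N" unfolding w_def
        using h A by (intro mult_mono power_mono) (auto simp: h_def)
      \<comment> \<open>The bound so far is absolute; the lower bound \<open>c1\<close> for
        \<open>u e_n\<close> converts it into a multiple of \<open>u e_n\<close>.\<close>
      also have "\<dots> = 2 * A * 2 ^ N / c1 * c1" using c1 by simp
      also have "\<dots> \<le> 2 * A * 2 ^ N / c1 * u e_n" using lam A c1 by (intro mult_left_mono) auto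
      also have "\<dots> \<le> C * u e_n" using lam c1 c2 unfolding C_def by (intro mult_right_mono) auto
      finally show ?thesis .
    next
      case False
      then have dh: "\<epsilon> * h < d" by simp
      \<comment> \<open>Small enough for \<open>near\<close> and, since
        \<open>\<epsilon> * h < d\<close>, smaller than the radius \<open>R\<close> of a ball above
        the graph.\<close>
      define \<rho> where "\<rho> = \<kappa> * \<epsilon> * h"
      have \<rho>: "0 < \<rho>" "\<rho> \<le> h / 4"
      proof -
        have "\<kappa> * \<epsilon> * h \<le> 1 * (1/4) * h" using \<kappa> \<epsilon> h by (intro mult_mono) auto
        then show "\<rho> \<le> h / 4" by (simp add: \<rho>_def)
      qed (use \<kappa> \<epsilon> h in \<open>simp add: \<rho>_def\<close>)
      define R where "R = \<kappa> * d"
      have R: "0 < R" "R \<le> 3" "\<rho> < R"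
        using \<kappa> d0 d3 dh mult_mono[of \<kappa> 1 d 3] by (auto simp: R_def \<rho>_def)
      have nR: "norm x + R \<le> 19" using Qn[OF x] R by simp
      have LR: "(1 + L) * R \<le> height x" using L by (simp add: R_def \<kappa>_def d_def)
      note hb = height_pos_ball[OF nR LR less_imp_le[OF R(1)]]
      have "cball x \<rho> \<subseteq> \<Omega>"
      proof
        fix z assume z: "z \<in> cball x \<rho>"
        then have "norm (z - x) \<le> 3" "z \<in> ball x R" using R by (auto simp: dist_norm norm_minus_commute)
        then show "z \<in> \<Omega>" using hb(2)[of z] Qn[OF x] norm_triangle_ineq2[of z x] by (intro \<Omega>I) auto
      qed
      moreover have "\<forall>z\<in>cball x \<rho>. u z \<le> 2 ^ N * u x"
        using near hb(1) \<rho> R h by (auto simp: dist_norm norm_minus_commute)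
      ultimately have um: "u x / 2 \<le> u z" if "z \<in> cball x (\<delta> * \<rho>)" for z
        using half[OF lane_emden _ \<rho>(1)] that by blast
      have \<delta>\<rho>: "0 < \<delta> * \<rho>" using \<delta> \<rho> by simp
      have \<delta>\<rho>R: "\<delta> * \<rho> < R" using mult_right_mono[OF \<delta>(2), of \<rho>] \<rho>(1) R(3) by linarith
      \<comment> \<open>The bound \<open>u x / 2\<close> on the ball of radius
        \<open>\<delta> * \<rho>\<close> is spread to radius \<open>R / 2\<close>, where the
        vertical chain can start.\<close>
      define m where "m = u x / 2 * (\<delta> * \<epsilon> * h / d) ^ n2"
      have m: "m > 0" using ux \<delta> \<epsilon> h d0 by (simp add: m_def)
      have mu: "m \<le> u z" if z: "z \<in> cball x (R / 2)" for z
      proof -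
        have "norm (z - x) \<le> R / 2" using z by (simp add: dist_norm norm_minus_commute)
        then have "(1 + 1) * (norm (z - x))\<^sup>2 \<le> R\<^sup>2" by (intro double_square_le) auto
        then have "u x / 2 * 1 * (\<delta> * \<rho> / R) ^ n2 \<le> u z"
          unfolding n2_def using hb um \<delta>\<rho> \<delta>\<rho>R ux by (intro propagate[OF nR]) auto
        moreover have "\<delta> * \<rho> / R = \<delta> * \<epsilon> * h / d" using \<kappa> by (simp add: \<rho>_def R_def)
        ultimately show ?thesis by (simp add: m_def)
      qed
      have R2: "R / 2 = (snd x - g (fst x)) / (2 * (1 + L))" by (simp add: R_def \<kappa>_def d_def height_def)
      have "c * (snd x - g (fst x)) ^ N1 * m \<le> u e_n"
      proof (rule chain[OF fs fx(1) _ _ m])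
        show "\<forall>y\<in>cball x ((snd x - g (fst x)) / (2 * (1 + L))). m \<le> u y"
          unfolding R2[symmetric] using mu by blast
      qed (use d0 d3 in \<open>simp_all add: d_def height_def\<close>)
      then have "c * d ^ N1 * m \<le> u e_n" by (simp add: d_def height_def)
      \<comment> \<open>Here \<open>\<epsilon> * h < d \<le> 3\<close> bounds the powers of
        \<open>d\<close> in numerator and denominator, and exactly \<open>u x * h ^ N\<close>
        remains.\<close>
      moreover have "c2 * w x \<le> c * d ^ N1 * m"
      proof -
        have "c2 * w x = c * (\<epsilon> * h) ^ N1 * (u x / 2 * (\<delta> * \<epsilon> * h / 3) ^ n2)"
          unfolding c2_def w_def N_def h_def by (simp add: power_add power_mult_distrib power_divide mult_ac)
        also have "\<dots> \<le> c * d ^ N1 * m" unfolding m_def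
          using c dh \<epsilon> h \<delta> d0 d3 ux by (intro mult_mono power_mono frac_le) auto
        finally show ?thesis .
      qed
      ultimately have "c2 * w x \<le> u e_n" by linarith
      then have "w x \<le> 1 / c2 * u e_n" using c2 by (simp add: field_simps)
      also have "\<dots> \<le> C * u e_n" using lam c1 A unfolding C_def by (intro mult_right_mono) auto
      finally show ?thesis .
    qed
    moreover have yQ: "y \<in> Q" using y by (simp add: Q_def height_def)
    \<comment> \<open>For points of norm at most 3/2 the weight is at least
      \<open>(1 / 2) ^ N\<close>.\<close>
    have "u y * (1 / 2) ^ N \<le> w y" unfolding w_def
      using y u_nonneg[of y] Qn[OF yQ] by (intro mult_left_mono power_mono) auto
    ultimately have "u y * (1 / 2) ^ N \<le> C * u e_n" using max[OF yQ] by linarith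
    then show ?thesis by (simp add: power_one_over field_simps)
  qed
  then show ?thesis using C by (intro exI[of _ "2 ^ N * C"]) auto
qed

section \<open>Growth along the axis\<close>

text \<open>The Carleson bound makes \<open>u\<close> comparable to \<open>u e_n\<close> near
  \<open>e_n\<close>. The unit ball about \<open>e_n\<close> lies above the graph and touches it at
  the origin, so propagation from the centre to its boundary has the effect of Hopf's lemma.\<close>

lemma axis_linear_lower_bound:
  fixes \<gamma> L :: real
  assumes \<gamma>: "\<gamma> > 1" and L: "L > 0"
  shows "\<exists>c>0. \<forall>(g :: real ^ 'm \<Rightarrow> real) u t. flat_solution \<gamma> L g u \<longrightarrow> 0 \<le> t \<longrightarrow> t \<le> 1 \<longrightarrow>
    c * (u e_n * t) \<le> u (t *\<^sub>R e_n)"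
proof -
  define n2 where "n2 = 2 * DIM((real ^ 'm) \<times> real)"
  obtain C where C: "C > 0" and
    car: "\<And>(g :: real ^ 'm \<Rightarrow> real) u y. \<lbrakk>flat_solution \<gamma> L g u; norm y \<le> 3/2; g (fst y) \<le> snd y\<rbrakk> \<Longrightarrow> u y \<le> C * u e_n"
    using carleson_estimate[OF \<gamma> L, where 'm = 'm] by metis
  have B: "max C 1 \<ge> 1" by simp
  obtain \<delta> where \<delta>: "0 < \<delta>" "\<delta> \<le> 1/4" and
    half: "\<And>S (u :: (real ^ 'm) \<times> real \<Rightarrow> real) x \<rho> y. \<lbrakk>lane_emden_on \<gamma> S u; cball x \<rho> \<subseteq> S; 0 < \<rho>;
      \<forall>y\<in>cball x \<rho>. u y \<le> max C 1 * u x; y \<in> cball x (\<delta> * \<rho>)\<rbrakk> \<Longrightarrow> u x / 2 \<le> u y"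
    using interior_half_bound[OF \<gamma> B, where 'a = "(real ^ 'm) \<times> real"] by metis
  have "(\<delta> / 2) ^ n2 / 2 * (u e_n * t) \<le> u (t *\<^sub>R e_n)"
    if fs: "flat_solution \<gamma> L g u" and t: "0 \<le> t" "t \<le> 1" for g :: "real ^ 'm \<Rightarrow> real" and u t
  proof -
    interpret flat_solution \<gamma> L g u by (rule fs)
    have en: "norm (e_n :: (real ^ 'm) \<times> real) = 1" by (simp add: e_n_def norm_Pair)
    have hen: "height e_n > 0" using flat'[of 0] by (simp add: height_def e_n_def)
    have up: "u e_n > 0" using u_pos en hen by simp
    have sub: "cball e_n (1/2) \<subseteq> \<Omega>" using axis_cball_subset[of 1] by simp
    have um: "u e_n / 2 \<le> u y" if "y \<in> cball e_n (\<delta> * (1/2))" for y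
    proof (rule half[OF lane_emden sub _ _ that])
      show "\<forall>y\<in>cball e_n (1/2). u y \<le> max C 1 * u e_n"
      proof
        fix y :: "(real ^ 'm) \<times> real" assume y: "y \<in> cball e_n (1/2)"
        have "norm y \<le> 3/2"
          using y en norm_triangle_ineq2[of y e_n] by (simp add: dist_norm norm_minus_commute)
        moreover have "g (fst y) \<le> snd y" using y sub by (auto simp: \<Omega>_def height_def)
        ultimately have "u y \<le> C * u e_n" by (rule car[OF fs])
        also have "\<dots> \<le> max C 1 * u e_n" using up by (intro mult_right_mono) auto
        finally show "u y \<le> max C 1 * u e_n" .
      qed
    qed simp
    \<comment> \<open>In the unit ball about \<open>e_n\<close> this gives |y|^2 <= 2 y_n, so the
      ball lies above the paraboloid |y'|^2 / 2 and all the more above the graph.\<close>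
    have ball1: "(norm (fst y))\<^sup>2 + (snd y)\<^sup>2 = (norm (y - e_n))\<^sup>2 + 2 * snd y - 1" for y :: "(real ^ 'm) \<times> real"
      unfolding e_n_def by (cases y) (simp add: norm_Pair, simp add: power2_eq_square algebra_simps)
    have n19: "norm y \<le> 19" if "y \<in> cball e_n 1" for y :: "(real ^ 'm) \<times> real"
      using that en norm_triangle_ineq2[of y e_n] by (simp add: dist_norm norm_minus_commute)
    have gl: "\<bar>g (fst y)\<bar> \<le> (norm (fst y))\<^sup>2 / 4000" if "y \<in> cball e_n 1" for y
      using n19[OF that] norm_fst_le_norm[of y] by (intro flat) auto
    \<comment> \<open>Propagation with \<open>\<epsilon> = t\<close>: the distance from
      \<open>t *\<^sub>R e_n\<close> to \<open>e_n\<close> is 1 - t, and (1 + t)(1 - t)^2 <=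
      1.\<close>
    have "u e_n / 2 * t * (\<delta> * (1/2) / 1) ^ n2 \<le> u (t *\<^sub>R e_n)" unfolding n2_def
    proof (rule propagate[OF _ _ _ _ _ _ um])
      show "0 \<le> height y" if "y \<in> cball e_n 1" for y
      proof -
        have "(norm (y - e_n))\<^sup>2 \<le> 1" using that by (simp add: dist_norm norm_minus_commute power_le_one)
        then have "(norm (fst y))\<^sup>2 + (snd y)\<^sup>2 \<le> 2 * snd y" using ball1[of y] by simp
        moreover have "0 \<le> (norm (fst y))\<^sup>2" "0 \<le> (snd y)\<^sup>2" by auto
        ultimately show ?thesis using gl[OF that] unfolding height_def by linarith
      qed
      show "0 < height y" if y: "y \<in> ball e_n 1" for y
      proof -
        have "(norm (y - e_n))\<^sup>2 < 1\<^sup>2"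
          using y by (intro power_strict_mono) (auto simp: dist_norm norm_minus_commute)
        then have "(norm (fst y))\<^sup>2 + (snd y)\<^sup>2 < 2 * snd y" using ball1[of y] by simp
        moreover have "0 \<le> (norm (fst y))\<^sup>2" "0 \<le> (snd y)\<^sup>2" by auto
        moreover have "y \<in> cball e_n 1" using y by auto
        ultimately show ?thesis using gl[of y] unfolding height_def by linarith
      qed
      have "norm (t *\<^sub>R e_n - e_n :: (real ^ 'm) \<times> real) = norm ((t - 1) *\<^sub>R (e_n :: (real ^ 'm) \<times> real))"
        by (simp add: algebra_simps)
      then have nt: "norm (t *\<^sub>R e_n - e_n :: (real ^ 'm) \<times> real) = 1 - t" using t en by simp
      have "(1 + t) * (1 - t) \<le> 1" by (simp add: algebra_simps)
      then have "(1 + t) * (1 - t) * (1 - t) \<le> 1 * 1" using t by (intro mult_mono) auto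
      then show "(1 + t) * (norm (t *\<^sub>R e_n - e_n :: (real ^ 'm) \<times> real))\<^sup>2 \<le> 1\<^sup>2"
        unfolding nt by (simp add: power2_eq_square mult.assoc)
    qed (use en \<delta> up t in auto)
    then show ?thesis by (simp add: mult_ac)
  qed
  then show ?thesis using \<delta> by (intro exI[of _ "(\<delta> / 2) ^ n2 / 2"]) auto
qed

text \<open>The barrier \<open>A * (\<rho> powr \<phi> + lam * \<rho>)\<close> is built on a
  function \<open>\<rho>\<close> vanishing on the unit sphere about \<open>- e_n\<close>, which
  touches the graph at the origin from below. Concavity of the power beats the right-hand side of
  the equation; the linear term dominates \<open>u\<close> on the unit sphere about 0, by the
  Carleson bound.\<close>

lemma axis_upper_bound:
  fixes \<gamma> L \<phi> :: real
  assumes \<gamma>: "\<gamma> > 1" and L: "L > 0" and \<phi>: "\<phi> = 2 / (1 + \<gamma>)"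
  shows "\<exists>A>0. \<forall>(g :: real ^ 'm \<Rightarrow> real) u t. flat_solution \<gamma> L g u \<longrightarrow> 0 \<le> t \<longrightarrow> t \<le> 1 \<longrightarrow>
    u (t *\<^sub>R e_n) \<le> A * (t powr \<phi> + u e_n * t)"
proof -
  note ph = phi_exponents[OF \<gamma> \<phi>]
  define n where "n = real DIM((real ^ 'm) \<times> real)"
  have n: "n \<ge> 1" by (simp add: n_def)
  obtain C where C: "C > 0" and
    car: "\<And>(g :: real ^ 'm \<Rightarrow> real) u y. \<lbrakk>flat_solution \<gamma> L g u; norm y \<le> 3/2; g (fst y) \<le> snd y\<rbrakk> \<Longrightarrow> u y \<le> C * u e_n"
    using carleson_estimate[OF \<gamma> L, where 'm = 'm] by metis
  \<comment> \<open>The concave power contributes \<open>- A * c * \<rho> powr (\<phi> - 2)\<close>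
    to the Laplacian, because squared distances to \<open>p\<close> lie between 1 and 4.\<close>
  define c where "c = 4 * (\<phi> * (1 - \<phi>)) * (4 powr (- n - 1))\<^sup>2"
  have c: "c > 0" using ph by (simp add: c_def)
  \<comment> \<open>\<open>3 * C\<close> because \<open>\<rho> \<ge> 1/3\<close> where
    \<open>norm z = 1\<close>; \<open>1 / c + 1\<close> because
    \<open>A powr (- \<gamma>) \<le> 1 / A\<close> has to stay below \<open>A * c\<close>.\<close>
  define A where "A = 3 * C + 1 / c + 1"
  have A: "A \<ge> 1" "A \<ge> 3 * C" "1 / A < A * c"
  proof -
    show A1: "A \<ge> 1" "A \<ge> 3 * C" using C c by (auto simp: A_def)
    have "1 < A * c" using C c by (simp add: A_def algebra_simps add_pos_pos)
    moreover have "1 / A \<le> 1" using A1 by simp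
    ultimately show "1 / A < A * c" by linarith
  qed
  have "u (t *\<^sub>R e_n) \<le> A * (2 * n) * (t powr \<phi> + u e_n * t)"
    if fs: "flat_solution \<gamma> L g u" and t: "0 \<le> t" "t \<le> 1" for g :: "real ^ 'm \<Rightarrow> real" and u t
  proof -
    interpret flat_solution \<gamma> L g u by (rule fs)
    define lam where "lam = u e_n"
    have en: "norm (e_n :: (real ^ 'm) \<times> real) = 1" by (simp add: e_n_def norm_Pair)
    have hen: "height e_n > 0" using flat'[of 0] by (simp add: height_def e_n_def)
    have up: "lam > 0" using u_pos en hen by (simp add: lam_def)
    have g0: "g 0 = 0" using flat[of 0] by simp
    define p :: "(real ^ 'm) \<times> real" where "p = - e_n"
    define Q where "Q = cball 0 1 \<inter> {y. 0 \<le> height y}"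
    have Qn: "norm z \<le> 19" "0 \<le> height z" "norm z \<le> 1" if "z \<in> Q" for z using that by (auto simp: Q_def)
    \<comment> \<open>Quadratic flatness bounds 2 y_n below by a small multiple of -|y|^2, so the
      exterior unit ball touches the region above the graph at the origin only.\<close>
    have sp: "1 + (norm y)\<^sup>2 / 2 \<le> (norm (y - p))\<^sup>2" "(norm (y - p))\<^sup>2 \<le> 4" if y: "y \<in> Q" for y
    proof -
      have e: "(norm (y - p))\<^sup>2 = (norm y)\<^sup>2 + 2 * snd y + 1"
        unfolding p_def e_n_def by (cases y) (simp add: norm_Pair, simp add: power2_eq_square algebra_simps)
      have "\<bar>g (fst y)\<bar> \<le> (norm (fst y))\<^sup>2 / 4000" using Qn[OF y] norm_fst_le_norm[of y] by (intro flat) auto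
      moreover have "(norm (fst y))\<^sup>2 \<le> (norm y)\<^sup>2" by (intro power_mono norm_fst_le_norm) auto
      moreover have "0 \<le> (norm y)\<^sup>2" by simp
      ultimately show "1 + (norm y)\<^sup>2 / 2 \<le> (norm (y - p))\<^sup>2"
        using e Qn(2)[OF y] unfolding height_def by linarith
      have "norm (y - p) \<le> 2" using norm_triangle_ineq[of y e_n] en Qn[OF y] by (simp add: p_def)
      then have "(norm (y - p))\<^sup>2 \<le> 2\<^sup>2" by (intro power_mono) auto
      then show "(norm (y - p))\<^sup>2 \<le> 4" by simp
    qed
    have s1: "1 \<le> (norm (y - p))\<^sup>2" if "y \<in> Q" for y using sp(1)[OF that] zero_le_power2[of "norm y"] by linarith
    define \<rho> where "\<rho> s = 1 - s powr (- n)" for s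
    define \<rho>' where "\<rho>' s = - (- n * s powr (- n - 1))" for s
    define \<rho>'' where "\<rho>'' s = - (n * (n + 1) * s powr (- n - 2))" for s
    have \<rho>0: "0 \<le> \<rho> s" if "1 \<le> s" for s
      using powr_mono2'[of "- n" 1 s] that n by (simp add: \<rho>_def)
    have \<rho>pos: "0 < \<rho> s" if "1 < s" for s
      using powr_less_mono2_neg[of "- n" 1 s] that n by (simp add: \<rho>_def)
    have d\<rho>: "(\<rho> has_real_derivative \<rho>' s) (at s)" "(\<rho>' has_real_derivative \<rho>'' s) (at s)"
      "2 * n * \<rho>' s + 4 * s * \<rho>'' s = - (n * (2 * n + 4) * s powr (- n - 1))" if "s > 0" for s
    proof -
      show "(\<rho> has_real_derivative \<rho>' s) (at s)" unfolding \<rho>_def \<rho>'_def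
        using DERIV_diff[OF DERIV_const inverse_power_radial(1)[OF that, of n], of 1] by simp
      show "(\<rho>' has_real_derivative \<rho>'' s) (at s)" unfolding \<rho>'_def \<rho>''_def
        by (rule DERIV_minus[OF inverse_power_radial(2)[OF that]])
      show "2 * n * \<rho>' s + 4 * s * \<rho>'' s = - (n * (2 * n + 4) * s powr (- n - 1))"
        unfolding \<rho>'_def \<rho>''_def inverse_power_radial(3)[OF that, symmetric] by (simp add: algebra_simps)
    qed
    define F where "F s = A * (\<rho> s powr \<phi> + lam * \<rho> s)" for s
    define F' where "F' s = A * ((\<phi> * \<rho> s powr (\<phi> - 1) + lam) * \<rho>' s)" for s
    define F'' where "F'' s = A * (\<phi> * ((\<phi> - 1) * \<rho> s powr (\<phi> - 2) * \<rho>' s) * \<rho>' s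
        + (\<phi> * \<rho> s powr (\<phi> - 1) + lam) * \<rho>'' s)" for s
    have pd: "((\<lambda>s. \<rho> s powr e) has_real_derivative e * \<rho> s powr (e - 1) * \<rho>' s) (at s)" if "1 < s" for s e
      using DERIV_chain2[OF has_real_derivative_powr[OF \<rho>pos[OF that]] d\<rho>(1)] that by simp
    have dF: "(F has_real_derivative F' s) (at s)" if "1 < s" for s
      unfolding F_def F'_def
      by (rule derivative_eq_intros pd that d\<rho>(1) refl)+ (use that in \<open>auto simp: algebra_simps\<close>)
    have dF': "(F' has_real_derivative F'' s) (at s)" if "1 < s" for s
    proof -
      have "(F' has_real_derivative A * ((\<phi> * ((\<phi> - 1) * \<rho> s powr (\<phi> - 1 - 1) * \<rho>' s) + 0) * \<rho>' s
          + \<rho>'' s * (\<phi> * \<rho> s powr (\<phi> - 1) + lam))) (at s)"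
        unfolding F'_def using that
        by (intro DERIV_cmult DERIV_mult DERIV_add DERIV_const pd d\<rho>(2)) auto
      then show ?thesis by (simp add: F''_def mult.commute)
    qed
    have lapF: "2 * n * F' s + 4 * s * F'' s \<le> - (A * c * \<rho> s powr (\<phi> - 2))" if s: "1 < s" "s \<le> 4" for s
    proof -
      have "2 * n * F' s + 4 * s * F'' s = A * (\<phi> * \<rho> s powr (\<phi> - 1) + lam) * (2 * n * \<rho>' s + 4 * s * \<rho>'' s)
          - A * (4 * (\<phi> * (1 - \<phi>))) * \<rho> s powr (\<phi> - 2) * (s * (\<rho>' s)\<^sup>2)"
        unfolding F'_def F''_def by (simp add: algebra_simps power2_eq_square)
      moreover have "A * (\<phi> * \<rho> s powr (\<phi> - 1) + lam) * (2 * n * \<rho>' s + 4 * s * \<rho>'' s) \<le> 0"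
      proof -
        have "0 \<le> A * (\<phi> * \<rho> s powr (\<phi> - 1) + lam)" using A ph up by simp
        moreover have "2 * n * \<rho>' s + 4 * s * \<rho>'' s \<le> 0" using d\<rho>(3)[of s] s n by simp
        ultimately show ?thesis by (rule mult_nonneg_nonpos)
      qed
      moreover have "(4 powr (- n - 1))\<^sup>2 \<le> s * (\<rho>' s)\<^sup>2"
      proof -
        have "4 powr (- n - 1) \<le> s powr (- n - 1)" using s n by (intro powr_mono2') auto
        also have "\<dots> \<le> \<rho>' s" using n mult_right_mono[of 1 n "s powr (- n - 1)"] by (simp add: \<rho>'_def)
        finally have "(4 powr (- n - 1))\<^sup>2 \<le> (\<rho>' s)\<^sup>2" by (intro power_mono) auto
        then have "1 * (4 powr (- n - 1))\<^sup>2 \<le> s * (\<rho>' s)\<^sup>2" using s by (intro mult_mono) auto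
        then show ?thesis by simp
      qed
      then have "A * (4 * (\<phi> * (1 - \<phi>))) * \<rho> s powr (\<phi> - 2) * (4 powr (- n - 1))\<^sup>2
          \<le> A * (4 * (\<phi> * (1 - \<phi>))) * \<rho> s powr (\<phi> - 2) * (s * (\<rho>' s)\<^sup>2)"
        using A ph by (intro mult_left_mono) auto
      moreover have "A * (4 * (\<phi> * (1 - \<phi>))) * \<rho> s powr (\<phi> - 2) * (4 powr (- n - 1))\<^sup>2 = A * c * \<rho> s powr (\<phi> - 2)"
        by (simp add: c_def mult_ac)
      ultimately show ?thesis by linarith
    qed
    have tQ: "t *\<^sub>R e_n \<in> Q" using t g0 by (simp add: Q_def height_def en) (simp add: e_n_def)
    have "1 * u (t *\<^sub>R e_n) \<le> 1 * F ((norm (t *\<^sub>R e_n - p))\<^sup>2)"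
    proof (rule radial_comparison[where Q = Q and S = \<Omega> and F' = F' and F'' = F''])
      show "compact Q" unfolding Q_def by (rule compact_upper_cball) auto
      show "continuous_on Q u" by (rule continuous_u) (auto simp: Qn)
      have c\<rho>: "continuous_on Q (\<lambda>y. \<rho> ((norm (y - p))\<^sup>2))"
        unfolding \<rho>_def using s1 by (intro continuous_intros) fastforce+
      have "continuous_on Q (\<lambda>y. \<rho> ((norm (y - p))\<^sup>2) powr \<phi>)"
        using c\<rho> s1 \<rho>0 ph by (intro continuous_on_powr' continuous_intros) auto
      then show "continuous_on Q (\<lambda>y. F ((norm (y - p))\<^sup>2))"
        unfolding F_def using c\<rho> by (intro continuous_on_mult continuous_on_add continuous_on_const)
      fix z s assume z: "z \<in> Q" and s: "s = (norm (z - p))\<^sup>2" and "1 * F s < 1 * u z"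
      then have lt: "F s < u z" by simp
      have F0: "A * \<rho> s powr \<phi> \<le> F s" "A * lam * \<rho> s \<le> F s" "0 \<le> F s"
      proof -
        have "0 \<le> A * \<rho> s powr \<phi>" "0 \<le> A * lam * \<rho> s"
          using A up \<rho>0[OF s1[OF z]] by (auto simp: s)
        moreover have "F s = A * \<rho> s powr \<phi> + A * lam * \<rho> s" by (simp add: F_def distrib_left mult.assoc)
        ultimately show "A * \<rho> s powr \<phi> \<le> F s" "A * lam * \<rho> s \<le> F s" "0 \<le> F s" by linarith+
      qed
      have hz: "height z > 0" using u_boundary[of z] lt F0(3) Qn[OF z] by (cases "height z = 0") auto
      \<comment> \<open>At the origin \<open>\<rho>\<close> vanishes and its power
        \<open>\<phi>\<close> is not differentiable; elsewhere in \<open>Q\<close> one has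
        \<open>s > 1\<close>, and the barrier is smooth.\<close>
      have "z \<noteq> 0" using hz g0 by (auto simp: height_def)
      then have "0 < (norm z)\<^sup>2" by simp
      then have s1': "1 < s" using sp(1)[OF z] unfolding s by linarith
      have s4: "s \<le> 4" using sp(2)[OF z] s by simp
      have "norm z \<noteq> 1"
      proof
        assume 1: "norm z = 1"
        then have "3/2 \<le> s" using sp(1)[OF z] s by simp
        then have "s powr (- n) \<le> (3/2) powr (- n)" using n by (intro powr_mono2') auto
        also have "\<dots> \<le> (3/2) powr (- 1)" using n by (intro powr_mono) auto
        also have "\<dots> = 2/3" by (simp add: powr_minus)
        finally have "1/3 \<le> \<rho> s" by (simp add: \<rho>_def)
        then have "A * lam * (1/3) \<le> A * lam * \<rho> s" using A up by (intro mult_left_mono) auto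
        moreover have "3 * C * lam \<le> A * lam" using A up by (intro mult_right_mono) auto
        moreover have "u z \<le> C * lam" unfolding lam_def using 1 Qn[OF z] by (intro car[OF fs]) (auto simp: height_def)
        ultimately show False using lt F0(2) by linarith
      qed
      then have "z \<in> ball 0 1" using Qn[OF z] by auto
      then have int: "z \<in> interior Q" unfolding Q_def using Qn[OF z] hz by (intro interior_upper_cball)
      have z\<Omega>: "z \<in> \<Omega>" using Qn[OF z] hz by (intro \<Omega>I)
      have "u z powr (- \<gamma>) \<le> (A * \<rho> s powr \<phi>) powr (- \<gamma>)"
        using lt F0(1) A \<rho>pos[OF s1'] \<gamma> by (intro powr_mono2') auto
      also have "\<dots> = A powr (- \<gamma>) * \<rho> s powr (\<phi> - 2)"
        using A \<rho>pos[OF s1'] by (intro powr_phi_neg_gamma[OF \<gamma> \<phi>]) auto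
      also have "\<dots> < A * c * \<rho> s powr (\<phi> - 2)"
      proof -
        have "A powr (- \<gamma>) \<le> A powr (- 1)" using A \<gamma> by (intro powr_mono) auto
        also have "\<dots> = 1 / A" using A by (simp add: powr_minus_divide)
        finally have "A powr (- \<gamma>) < A * c" using A by linarith
        then show ?thesis using \<rho>pos[OF s1'] by (intro mult_strict_right_mono) auto
      qed
      finally have "2 * n * F' s + 4 * s * F'' s < laplacian u z"
        using lapF[OF s1' s4] \<Omega>_props z\<Omega> by force
      moreover have "\<forall>\<^sub>F s in nhds s. (F has_real_derivative F' s) (at s)"
        using s1' dF by (auto simp: eventually_nhds intro!: exI[of _ "{1<..}"])
      ultimately show "z \<in> interior Q \<and> z \<in> \<Omega> \<and> (\<forall>\<^sub>F s in nhds s. (F has_real_derivative F' s) (at s)) \<and>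
          (F' has_real_derivative F'' s) (at s) \<and>
          1 * (2 * real DIM((real ^ 'm) \<times> real) * F' s + 4 * s * F'' s) < 1 * laplacian u z"
        using int z\<Omega> dF'[OF s1'] unfolding n_def by simp
    qed (use \<Omega>_props tQ in auto)
    moreover have "norm (t *\<^sub>R e_n - p) = 1 + t"
    proof -
      have "t *\<^sub>R e_n - p = (1 + t) *\<^sub>R (e_n :: (real ^ 'm) \<times> real)" by (simp add: p_def algebra_simps)
      then show ?thesis using t en by simp
    qed
    ultimately have ut: "u (t *\<^sub>R e_n) \<le> F ((1 + t)\<^sup>2)" by simp
    define \<rho>t where "\<rho>t = \<rho> ((1 + t)\<^sup>2)"
    have r0: "0 \<le> \<rho>t" unfolding \<rho>t_def using t by (intro \<rho>0) (simp add: one_le_power)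
    \<comment> \<open>This is 1 - (1 + t)^(-2n) <= 2nt, from exp x >= 1 + x and ln(1 + t) <=
      t.\<close>
    have r1: "\<rho>t \<le> 2 * n * t"
    proof -
      have "ln ((1 + t)\<^sup>2) = 2 * ln (1 + t)" using t by (simp add: ln_realpow)
      then have "((1 + t)\<^sup>2) powr (- n) = exp (- n * (2 * ln (1 + t)))" using t by (simp add: powr_def)
      moreover have "1 + (- n * (2 * ln (1 + t))) \<le> exp (- n * (2 * ln (1 + t)))" by (rule exp_ge_add_one_self)
      moreover have "n * (2 * ln (1 + t)) \<le> n * (2 * t)"
        using n t ln_add_one_self_le_self[of t] by (intro mult_left_mono) auto
      ultimately show ?thesis by (simp add: \<rho>t_def \<rho>_def)
    qed
    have "\<rho>t powr \<phi> \<le> (2 * n * t) powr \<phi>" using r0 r1 ph by (intro powr_mono2) auto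
    also have "\<dots> = (2 * n) powr \<phi> * t powr \<phi>" using n t by (simp add: powr_mult)
    also have "\<dots> \<le> (2 * n) powr 1 * t powr \<phi>"
      using n ph by (intro mult_right_mono powr_mono) auto
    finally have r2: "\<rho>t powr \<phi> \<le> 2 * n * t powr \<phi>" using n by simp
    have "F ((1 + t)\<^sup>2) = A * (\<rho>t powr \<phi> + lam * \<rho>t)" by (simp add: F_def \<rho>t_def)
    also have "\<dots> \<le> A * (2 * n * t powr \<phi> + lam * (2 * n * t))"
      using A up r1 r2 by (intro mult_left_mono add_mono) auto
    also have "\<dots> = A * (2 * n) * (t powr \<phi> + u e_n * t)" by (simp add: lam_def algebra_simps)
    finally show ?thesis using ut by simp
  qed
  then show ?thesis using A n by (intro exI[of _ "A * (2 * n)"]) auto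
qed

section \<open>From the hypotheses on the graph to flat solutions, and conclusion\<close>

lemma C01_norm_lipschitz:
  assumes "C01_norm S g \<le> ennreal L" "0 \<le> L" "x \<in> S" "y \<in> S"
  shows "\<bar>g x - g y\<bar> \<le> L * dist x y"
proof (cases "x = y")
  case False
  have "ennreal (\<bar>g x - g y\<bar> / dist x y) \<le>
      (SUP (x, y)\<in>{(x, y). x \<in> S \<and> y \<in> S \<and> x \<noteq> y}. ennreal (\<bar>g x - g y\<bar> / dist x y))"
    using assms False by (intro SUP_upper2[of "(x, y)"]) auto
  also have "\<dots> \<le> C01_norm S g" unfolding C01_norm_def by simp
  also have "\<dots> \<le> ennreal L" by fact
  finally have "\<bar>g x - g y\<bar> / dist x y \<le> L" using assms by (simp add: ennreal_le_iff)
  then show ?thesis using False by (simp add: field_simps)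
qed simp

text \<open>The square of \<open>1 / K - K * r\<^sup>2\<close> is
  \<open>1 / K\<^sup>2 - 2 * r\<^sup>2 + (K * r)\<^sup>2 * r\<^sup>2\<close>, and the last term is
  at most \<open>r\<^sup>2\<close>.\<close>

lemma tangent_ball_quadratic:
  fixes K r :: real
  assumes "0 < K" "0 \<le> r" "K * r \<le> 1"
  shows "1 / K - sqrt (1 / K\<^sup>2 - r\<^sup>2) \<le> K * r\<^sup>2"
proof -
  have "(K * r)\<^sup>2 \<le> 1" using assms by (intro power_le_one) auto
  then have le: "(K * r)\<^sup>2 * r\<^sup>2 \<le> 1 * r\<^sup>2" by (intro mult_right_mono) auto
  have "(1 / K - K * r\<^sup>2)\<^sup>2 \<le> 1 / K\<^sup>2 - r\<^sup>2"
  proof -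
    have "(1 / K - K * r\<^sup>2)\<^sup>2 = 1 / K\<^sup>2 - 2 * r\<^sup>2 + (K * r)\<^sup>2 * r\<^sup>2"
      using assms by (simp add: power2_eq_square field_simps)
    then show ?thesis using le by simp
  qed
  then have "1 / K - K * r\<^sup>2 \<le> sqrt (1 / K\<^sup>2 - r\<^sup>2)" by (rule real_le_rsqrt)
  then show ?thesis by simp
qed

text \<open>The threshold exponent is the reciprocal of \<open>\<phi> - 1 < 0\<close>. Thus
  \<open>t powr \<phi> = t * t powr (\<phi> - 1)\<close> meets \<open>lam * t\<close> exactly at the
  threshold, and the decreasing factor decides which is larger.\<close>

lemma threshold_cases:
  fixes \<gamma> \<phi> lam t :: real
  assumes \<gamma>: "\<gamma> > 1" and \<phi>: "\<phi> = 2 / (1 + \<gamma>)" and lam: "lam > 0" and t: "0 \<le> t"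
  shows "t \<le> lam powr ((1 + \<gamma>) / (1 - \<gamma>)) \<Longrightarrow> lam * t \<le> t powr \<phi>"
    and "t \<ge> lam powr ((1 + \<gamma>) / (1 - \<gamma>)) \<Longrightarrow> t powr \<phi> \<le> lam * t"
proof -
  define \<beta> where "\<beta> = (1 - \<gamma>) / (1 + \<gamma>)"
  have \<beta>: "\<beta> < 0" "\<phi> = 1 + \<beta>" using \<gamma> \<phi> by (auto simp: \<beta>_def field_simps divide_neg_pos)
  have inv: "(1 + \<gamma>) / (1 - \<gamma>) * \<beta> = 1" using \<gamma> by (simp add: \<beta>_def)
  have lamp: "(lam powr ((1 + \<gamma>) / (1 - \<gamma>))) powr \<beta> = lam"
    using lam unfolding powr_powr inv by simp
  have tp: "t powr \<phi> = t * t powr \<beta>" if "t > 0" using that by (simp add: \<beta> powr_add)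
  show "lam * t \<le> t powr \<phi>" if "t \<le> lam powr ((1 + \<gamma>) / (1 - \<gamma>))"
  proof (cases "t = 0")
    case False
    then have "t > 0" using t by simp
    then have "(lam powr ((1 + \<gamma>) / (1 - \<gamma>))) powr \<beta> \<le> t powr \<beta>" using that \<beta> by (intro powr_mono2') auto
    then show ?thesis using \<open>t > 0\<close> by (simp add: lamp tp mult.commute)
  qed simp
  show "t powr \<phi> \<le> lam * t" if *: "t \<ge> lam powr ((1 + \<gamma>) / (1 - \<gamma>))"
  proof -
    have lp: "0 < lam powr ((1 + \<gamma>) / (1 - \<gamma>))" using lam by simp
    then have "t > 0" using * by linarith
    have "t powr \<beta> \<le> (lam powr ((1 + \<gamma>) / (1 - \<gamma>))) powr \<beta>" using * lp \<beta> by (intro powr_mono2') auto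
    then show ?thesis using \<open>t > 0\<close> by (simp add: lamp tp mult.commute)
  qed
qed

lemma flat_solution_tangent_balls:
  fixes g :: "real ^ 'm \<Rightarrow> real"
  assumes "\<gamma> > 1" "L > 0" "0 < K" "K \<le> 1/4000" "C01_norm (ball 0 20) g \<le> ennreal L"
    and tb: "\<forall>x\<in>ball 0 20. - (1 / K) + sqrt (1 / K\<^sup>2 - (norm x)\<^sup>2) \<le> g x \<and>
                      g x \<le> 1 / K - sqrt (1 / K\<^sup>2 - (norm x)\<^sup>2)"
    and "is_solution \<gamma> g 20 u"
  shows "flat_solution \<gamma> L g u"
proof
  show "\<bar>g x - g y\<bar> \<le> L * norm (x - y)" if "x \<in> ball 0 20" "y \<in> ball 0 20" for x y
    using C01_norm_lipschitz[OF assms(5) _ that] assms by (simp add: dist_norm)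
  show "\<bar>g x\<bar> \<le> (norm x)\<^sup>2 / 4000" if x: "x \<in> ball 0 20" for x
  proof -
    have "K * norm x \<le> 1/4000 * 20" using assms x by (intro mult_mono) auto
    then have "1 / K - sqrt (1 / K\<^sup>2 - (norm x)\<^sup>2) \<le> K * (norm x)\<^sup>2"
      using assms by (intro tangent_ball_quadratic) auto
    also have "\<dots> \<le> 1/4000 * (norm x)\<^sup>2" using assms by (intro mult_right_mono) auto
    finally have "1 / K - sqrt (1 / K\<^sup>2 - (norm x)\<^sup>2) \<le> (norm x)\<^sup>2 / 4000" by simp
    moreover have "- (1 / K) + sqrt (1 / K\<^sup>2 - (norm x)\<^sup>2) \<le> g x" "g x \<le> 1 / K - sqrt (1 / K\<^sup>2 - (norm x)\<^sup>2)"
      using tb x by blast+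
    ultimately show ?thesis by linarith
  qed
qed (use assms in auto)

text \<open>Collects all bounds under one constant; the upper bound carries \<open>C / 2\<close> so
  that replacing both summands by the larger one gives \<open>C\<close>.\<close>

lemma flat_solution_axis_bounds:
  fixes \<gamma> L \<phi> :: real
  assumes \<gamma>: "\<gamma> > 1" and L: "L > 0" and \<phi>: "\<phi> = 2 / (1 + \<gamma>)"
  shows "\<exists>C>0. \<forall>(g :: real ^ 'm \<Rightarrow> real) u. flat_solution \<gamma> L g u \<longrightarrow>
    1 \<le> C * u e_n \<and> (\<forall>t\<in>{0..1}. u (t *\<^sub>R e_n) \<le> C / 2 * (t powr \<phi> + u e_n * t) \<and>
      t powr \<phi> \<le> C * u (t *\<^sub>R e_n) \<and> u e_n * t \<le> C * u (t *\<^sub>R e_n))"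
proof -
  obtain A where A: "A > 0" and up: "\<And>(g :: real ^ 'm \<Rightarrow> real) u t. \<lbrakk>flat_solution \<gamma> L g u; 0 \<le> t; t \<le> 1\<rbrakk> \<Longrightarrow>
    u (t *\<^sub>R e_n) \<le> A * (t powr \<phi> + u e_n * t)"
    using axis_upper_bound[OF \<gamma> L \<phi>, where 'm = 'm] by metis
  obtain c where c: "c > 0" and low: "\<And>(g :: real ^ 'm \<Rightarrow> real) u t. \<lbrakk>flat_solution \<gamma> L g u; 0 \<le> t; t \<le> 1\<rbrakk> \<Longrightarrow>
    c * (u e_n * t) \<le> u (t *\<^sub>R e_n)"
    using axis_linear_lower_bound[OF \<gamma> L, where 'm = 'm] by metis
  define c1 where "c1 = (1 / 2) powr \<phi> / (4 * DIM((real ^ 'm) \<times> real))"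
  have c1: "c1 > 0" by (simp add: c1_def)
  define C where "C = 2 * A + 1 / c + 1 / c1"
  have C: "C > 0" "A \<le> C / 2" "1 / c \<le> C" "1 / c1 \<le> C" using A c c1 by (auto simp: C_def add_pos_pos)
  have CI: "a \<le> C * b" if "d * a \<le> b" "0 < d" "1 / d \<le> C" "0 \<le> b" for a b d
  proof -
    have "a \<le> 1 / d * b" using that by (simp add: field_simps)
    also have "\<dots> \<le> C * b" using that by (intro mult_right_mono) auto
    finally show ?thesis .
  qed
  show ?thesis
  proof (intro exI[of _ C] conjI allI impI ballI C)
    fix g :: "real ^ 'm \<Rightarrow> real" and u and t :: real
    assume fs: "flat_solution \<gamma> L g u"
    interpret flat_solution \<gamma> L g u by (rule fs)
    have c1t: "c1 * t powr \<phi> \<le> u (t *\<^sub>R e_n)" if "0 < t" "t \<le> 1" for t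
      using axis_lower_bound[OF that \<phi>] that by (simp add: c1_def powr_divide field_simps)
    have en: "u e_n > 0" using c1t[of 1] c1 by simp
    show "1 \<le> C * u e_n" using c1t[of 1] c1 en C by (intro CI[of c1]) auto
    assume "t \<in> {0..1}"
    then have t: "0 \<le> t" "t \<le> 1" by auto
    have ut: "0 \<le> u (t *\<^sub>R e_n)" using low[OF fs t] c en t by (meson mult_nonneg_nonneg less_imp_le order_trans)
    show "u (t *\<^sub>R e_n) \<le> C / 2 * (t powr \<phi> + u e_n * t)"
      using up[OF fs t] mult_right_mono[OF C(2), of "t powr \<phi> + u e_n * t"] en t by simp
    show "t powr \<phi> \<le> C * u (t *\<^sub>R e_n)"
    proof (cases "t = 0")
      case False
      then show ?thesis using c1t[of t] t c1 C ut by (intro CI[of c1]) auto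
    qed (use ut C in simp)
    show "u e_n * t \<le> C * u (t *\<^sub>R e_n)" using low[OF fs t] c C ut by (intro CI[of c]) auto
  qed
qed

theorem theorem3p1:
  fixes \<gamma> L \<phi> :: real
  assumes "\<gamma> > 1" and "L > 0" and "\<phi> = 2 / (1 + \<gamma>)"
  shows "\<exists>K\<^sub>0>0. \<forall>K. 0 < K \<and> K \<le> K\<^sub>0 \<longrightarrow>
    (\<exists>C>0. \<forall>(g :: real ^ 'm \<Rightarrow> real) (u :: (real ^ 'm) \<times> real \<Rightarrow> real) lam.
       C01_norm (ball 0 20) g \<le> ennreal L \<and>
       (\<forall>x\<in>ball 0 20. - (1 / K) + sqrt (1 / K\<^sup>2 - (norm x)\<^sup>2) \<le> g x \<and>
                      g x \<le> 1 / K - sqrt (1 / K\<^sup>2 - (norm x)\<^sup>2)) \<and>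
       is_solution \<gamma> g 20 u \<and>
       lam = u e_n \<longrightarrow>
       1 \<le> C * lam \<and>
       (\<forall>t\<in>{0..1}.
          (t \<le> lam powr ((1 + \<gamma>) / (1 - \<gamma>)) \<longrightarrow>
             u (t *\<^sub>R e_n) \<le> C * t powr \<phi> \<and> t powr \<phi> \<le> C * u (t *\<^sub>R e_n)) \<and>
          (t \<ge> lam powr ((1 + \<gamma>) / (1 - \<gamma>)) \<longrightarrow>
             u (t *\<^sub>R e_n) \<le> C * (lam * t) \<and> lam * t \<le> C * u (t *\<^sub>R e_n))))"
proof -
  obtain C where C: "C > 0" and bounds: "\<And>(g :: real ^ 'm \<Rightarrow> real) u. flat_solution \<gamma> L g u \<Longrightarrow>
    1 \<le> C * u e_n \<and> (\<forall>t\<in>{0..1}. u (t *\<^sub>R e_n) \<le> C / 2 * (t powr \<phi> + u e_n * t) \<and>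
      t powr \<phi> \<le> C * u (t *\<^sub>R e_n) \<and> u e_n * t \<le> C * u (t *\<^sub>R e_n))"
    using flat_solution_axis_bounds[OF assms, where 'm = 'm] by metis
  have main: "1 \<le> C * lam \<and>
       (\<forall>t\<in>{0..1}.
          (t \<le> lam powr ((1 + \<gamma>) / (1 - \<gamma>)) \<longrightarrow>
             u (t *\<^sub>R e_n) \<le> C * t powr \<phi> \<and> t powr \<phi> \<le> C * u (t *\<^sub>R e_n)) \<and>
          (t \<ge> lam powr ((1 + \<gamma>) / (1 - \<gamma>)) \<longrightarrow>
             u (t *\<^sub>R e_n) \<le> C * (lam * t) \<and> lam * t \<le> C * u (t *\<^sub>R e_n)))"
    if fs: "flat_solution \<gamma> L g u" and lam: "lam = u e_n" for g :: "real ^ 'm \<Rightarrow> real" and u lam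
  proof -
    have "0 < C * lam" using bounds[OF fs] lam by simp
    then have lam0: "lam > 0" using C by (simp add: zero_less_mult_iff)
    \<comment> \<open>To be used with \<open>b\<close> the larger of the two terms, which depends on
      the side of the threshold.\<close>
    have "u (t *\<^sub>R e_n) \<le> C * b"
      if "t \<in> {0..1}" "t powr \<phi> \<le> b" "lam * t \<le> b" for t b
    proof -
      have "u (t *\<^sub>R e_n) \<le> C / 2 * (t powr \<phi> + lam * t)" using bounds[OF fs] that lam by auto
      also have "\<dots> \<le> C / 2 * (b + b)" using C that by (intro mult_left_mono add_mono) auto
      finally show ?thesis by simp
    qed
    then show ?thesis
      using bounds[OF fs] threshold_cases[OF assms(1,3) lam0] lam by auto
  qed
  show ?thesis
  \<comment> \<open>The value of \<open>K\<close> for which the graph is flat enough for the locale;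
    \<open>C\<close> was fixed before \<open>K\<close> and so is uniform in it.\<close>
  proof (rule exI[of _ "1/4000"], intro conjI allI impI)
    fix K :: real assume K: "0 < K \<and> K \<le> 1/4000"
    show "\<exists>C>0. \<forall>(g :: real ^ 'm \<Rightarrow> real) (u :: (real ^ 'm) \<times> real \<Rightarrow> real) lam.
       C01_norm (ball 0 20) g \<le> ennreal L \<and>
       (\<forall>x\<in>ball 0 20. - (1 / K) + sqrt (1 / K\<^sup>2 - (norm x)\<^sup>2) \<le> g x \<and>
                      g x \<le> 1 / K - sqrt (1 / K\<^sup>2 - (norm x)\<^sup>2)) \<and>
       is_solution \<gamma> g 20 u \<and>
       lam = u e_n \<longrightarrow>
       1 \<le> C * lam \<and>
       (\<forall>t\<in>{0..1}.
          (t \<le> lam powr ((1 + \<gamma>) / (1 - \<gamma>)) \<longrightarrow>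
             u (t *\<^sub>R e_n) \<le> C * t powr \<phi> \<and> t powr \<phi> \<le> C * u (t *\<^sub>R e_n)) \<and>
          (t \<ge> lam powr ((1 + \<gamma>) / (1 - \<gamma>)) \<longrightarrow>
             u (t *\<^sub>R e_n) \<le> C * (lam * t) \<and> lam * t \<le> C * u (t *\<^sub>R e_n)))"
      using K C assms(1,2)
      by (intro exI[of _ C] conjI[OF C] allI impI main flat_solution_tangent_balls[where K = K]) blast+
  qed simp
qed

end
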